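(* Suppose $\phi=\psi_\alpha$ for $0<\alpha<1$ in a full residual network (FRN), with mean-field quantities $p^{(l)},\gamma^{(l)},e^{(l)},s^{(l)}$. Then $e^{(l)}$ converges to the unique nonunit fixed point $e^*$ of $\mathbb J_\alpha$, and $|e^*-e^{(l)}|$ is $\check\Theta(l^{-\mu})$, where $\mu=(1-\dot{\mathbb J}_\alpha(e^* ))/(1-\alpha)$. Additionally, $s^{(l)}=\Theta(p^{(l)})=\Theta(l^{1/(1-\alpha)})$.
   Context: The $\alpha$-ReLU is $\psi_\alpha(x)=x^\alpha$ for $x>0$ and $\psi_\alpha(x)=0$ otherwise. Put $\mathrm V\phi(q)=\mathbb E[\phi(z)^2]$ for $z\sim\mathcal N(0,q)$, and $\mathrm W\phi(\rho,\nu)=\mathbb E[\phi(z)\phi(z')]$ for $(z,z')\sim\mathcal N\!\left(0,\begin{pmatrix}\rho&\nu\\ \nu&\rho\end{pmatrix}\right)$. The kernel function $\mathbb J_\alpha$ is given by $\mathbb J_\alpha(c)=\mathrm W\psi_\alpha(q,cq)/\mathrm V\psi_\alpha(q)$, which does not depend on $q>0$; $\dot{\mathbb J}_\alpha$ is its derivative. A nonunit fixed point is one different from $1$. An FRN of width $N$ has layers $x^{(l)}_i=\sum_jv^{(l)}_{ij}\phi(h^{(l)}_j)+x^{(l-1)}_i+a^{(l)}_i$, $h^{(l)}_i=\sum_jw^{(l)}_{ij}x^{(l-1)}_j+b^{(l)}_i$ with independent Gaussian parameters of mean $0$ and variances $\sigma_v^2/N$, $\sigma_a^2$, $\sigma_w^2/N$,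 $\sigma_b^2$ respectively for $v,a,w,b$. Take two inputs $x^{(0)},x^{(0)\prime}$ with the same normalized squared length $p^{(0)}=\|x^{(0)}\|^2/N=\|x^{(0)\prime}\|^2/N$, and let $\gamma^{(0)}=x^{(0)}\cdot x^{(0)\prime}/N$. The mean-field ($N\to\infty$) quantities $p^{(l)}=\langle (x^{(l)}_1)^2\rangle$, $q^{(l)}=\langle (h^{(l)}_1)^2\rangle$, $\gamma^{(l)}=\langle x^{(l)}_1x^{(l)\prime}_1\rangle$, $\lambda^{(l)}=\langle h^{(l)}_1h^{(l)\prime}_1\rangle$ satisfy, for $l\ge1$, $$q^{(l)}=\sigma_w^2p^{(l-1)}+\sigma_b^2,\quad p^{(l)}=\sigma_v^2\,\mathrm V\phi(q^{(l)})+\sigma_a^2+p^{(l-1)},$$ $$\lambda^{(l)}=\sigma_w^2\gamma^{(l-1)}+\sigma_b^2,\quad \gamma^{(l)}=\sigma_v^2\,\mathrm W\phi(q^{(l)},\lambda^{(l)})+\sigma_a^2+\gamma^{(l-1)}.$$ Further $e^{(l)}=\gamma^{(l)}/p^{(l)}$ and $s^{(l)}=p^{(l)}-\gamma^{(l)}=(1-e^{(l)})p^{(l)}$. Asymptotics are as $l\to\infty$. $f=\check\Theta(g)$ means that for every $\varepsilon>0$, $f(l)=O(g(l)l^{\varepsilon})$ and $f(l)=\Omega(g(l)l^{-\varepsilon})$.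
   Formalization: The upper half of the rate l^{-μ} is claimed only if σ_a=0 or 1−J̇_α(e* )≤α (otherwise it is false), the lower half for every γ^(0) except at most one unspecified value; σ_v,σ_w>0 and distinct inputs (γ^(0)<p^(0)) are assumed. *)

theory Defs
  imports "HOL-Probability.Probability"
begin

definition alpha_relu :: "real \<Rightarrow> real \<Rightarrow> real" where
  "alpha_relu \<alpha> x = (if x > 0 then x powr \<alpha> else 0)"

abbreviation std_gaussian :: "real measure" where
  "std_gaussian \<equiv> density lborel std_normal_density"

(* The centred normal law of variance q \<ge> 0, as an image of the standard one, so that q = 0
   gives the point mass at 0; see gaussian_eq_density. *)
definition gaussian :: "real \<Rightarrow> real measure" where
  "gaussian q = distr std_gaussian borel (\<lambda>x. sqrt q * x)"

(* The centred bivariate normal law with both variances \<rho> and covariance \<nu>, where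
   \<bar>\<nu>\<bar> \<le> \<rho>.  It is the image of two independent standard normals under a square root of the
   covariance matrix, which also covers the singular case \<bar>\<nu>\<bar> = \<rho>; see gaussian_pair_linear. *)
definition gaussian_pair :: "real \<Rightarrow> real \<Rightarrow> (real \<times> real) measure" where
  "gaussian_pair \<rho> \<nu> = distr (std_gaussian \<Otimes>\<^sub>M std_gaussian) (borel \<Otimes>\<^sub>M borel)
     (\<lambda>(x, y). (sqrt ((\<rho> + \<nu>) / 2) * x + sqrt ((\<rho> - \<nu>) / 2) * y,
               sqrt ((\<rho> + \<nu>) / 2) * x - sqrt ((\<rho> - \<nu>) / 2) * y))"

definition Vt :: "(real \<Rightarrow> real) \<Rightarrow> real \<Rightarrow> real" where
  "Vt \<phi> q = (\<integral>z. (\<phi> z)\<^sup>2 \<partial>gaussian q)"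

definition Wt :: "(real \<Rightarrow> real) \<Rightarrow> real \<Rightarrow> real \<Rightarrow> real" where
  "Wt \<phi> \<rho> \<nu> = (\<integral>(z, z'). \<phi> z * \<phi> z' \<partial>gaussian_pair \<rho> \<nu>)"

(* Normalised at q = 1; by JJ_eq the same quotient is obtained for every q > 0. *)
definition JJ :: "real \<Rightarrow> real \<Rightarrow> real" where
  "JJ \<alpha> c = Wt (alpha_relu \<alpha>) 1 c / Vt (alpha_relu \<alpha>) 1"

(* The covariance matrix with entries q and c q is positive semidefinite only for \<bar>c\<bar> \<le> 1. *)
definition nonunit_fixed_point :: "real \<Rightarrow> real \<Rightarrow> bool" where
  "nonunit_fixed_point \<alpha> c \<longleftrightarrow> c \<in> {-1..1} \<and> c \<noteq> 1 \<and> JJ \<alpha> c = c"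

definition frn_mean_field ::
  "(real \<Rightarrow> real) \<Rightarrow> real \<Rightarrow> real \<Rightarrow> real \<Rightarrow> real \<Rightarrow>
   (nat \<Rightarrow> real) \<Rightarrow> (nat \<Rightarrow> real) \<Rightarrow> (nat \<Rightarrow> real) \<Rightarrow> (nat \<Rightarrow> real) \<Rightarrow> bool" where
  "frn_mean_field \<phi> \<sigma>v \<sigma>a \<sigma>w \<sigma>b p q \<gamma> lam \<longleftrightarrow> (\<forall>l\<ge>1.
     q l = \<sigma>w\<^sup>2 * p (l - 1) + \<sigma>b\<^sup>2 \<and>
     p l = \<sigma>v\<^sup>2 * Vt \<phi> (q l) + \<sigma>a\<^sup>2 + p (l - 1) \<and>
     lam l = \<sigma>w\<^sup>2 * \<gamma> (l - 1) + \<sigma>b\<^sup>2 \<and>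
     \<gamma> l = \<sigma>v\<^sup>2 * Wt \<phi> (q l) (lam l) + \<sigma>a\<^sup>2 + \<gamma> (l - 1))"

(* soft_bigo and soft_bigomega are the two halves of "Theta up to factors l^\<epsilon>".  For the rate
   r = l^(-\<mu>), \<mu> = (1 - deriv JJ e) / (1 - \<alpha>), at the nonunit fixed point e, each half has its own
   exceptions:
   - lower: \<gamma> l / p l can start exactly at e (frn_mean_field_fixed_ratio), or, with biases present,
     on the one trajectory whose l^(-\<mu>) term vanishes;
   - upper: \<sigma>a\<^sup>2 (1 - e) drives \<gamma> l / p l away from e by the order of l^(-\<alpha> / (1 - \<alpha>)), which
     exceeds l^(-\<mu>) when \<sigma>a \<noteq> 0 and 1 - deriv JJ e > \<alpha>. *)
definition soft_bigo :: "(nat \<Rightarrow> real) \<Rightarrow> (nat \<Rightarrow> real) \<Rightarrow> bool" where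
  "soft_bigo f g \<longleftrightarrow> (\<forall>\<epsilon>>0. f \<in> O(\<lambda>l. g l * real l powr \<epsilon>))"

definition soft_bigomega :: "(nat \<Rightarrow> real) \<Rightarrow> (nat \<Rightarrow> real) \<Rightarrow> bool" where
  "soft_bigomega f g \<longleftrightarrow> (\<forall>\<epsilon>>0. f \<in> \<Omega>(\<lambda>l. g l * real l powr (-\<epsilon>)))"

lemma prob_space_std_gaussian: "prob_space std_gaussian"
  by (rule prob_space_normal_density) simp

lemma std_gaussian_scale:
  assumes "u \<noteq> 0"
  shows "distr std_gaussian borel (\<lambda>x. u * x) = density lborel (normal_density 0 \<bar>u\<bar>)"
proof -
  interpret prob_space std_gaussian by (rule prob_space_std_gaussian)
  have "distributed std_gaussian lborel (\<lambda>x. x) std_normal_density"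
    by (auto simp: distributed_def distr_id2 cong: distr_cong)
  from normal_density_affine[OF this _ assms, of 0]
  have "distributed std_gaussian lborel (\<lambda>x. u * x) (normal_density 0 \<bar>u\<bar>)" by simp
  then show ?thesis by (auto simp: distributed_def cong: distr_cong)
qed

lemma gaussian_eq_density:
  "q > 0 \<Longrightarrow> gaussian q = density lborel (normal_density 0 (sqrt q))"
  unfolding gaussian_def by (subst std_gaussian_scale) auto

lemma gaussian_zero: "gaussian 0 = return borel 0"
proof -
  have "distr std_gaussian borel (\<lambda>x. 0 :: real) = return borel 0"
    by (rule prob_space.distr_const[OF prob_space_std_gaussian]) simp
  then show ?thesis by (simp add: gaussian_def)
qed

lemma gaussian_scale: "distr std_gaussian borel (\<lambda>x. u * x) = gaussian (u\<^sup>2)"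
proof (cases "u = 0")
  case False
  then have "u\<^sup>2 > 0" by simp
  then show ?thesis using False
    by (simp add: std_gaussian_scale gaussian_eq_density)
next
  case True
  then show ?thesis by (simp add: gaussian_def)
qed

lemma std_gaussian_linear:
  "distr (std_gaussian \<Otimes>\<^sub>M std_gaussian) borel (\<lambda>(x, y). u * x + v * y) = gaussian (u\<^sup>2 + v\<^sup>2)"
proof -
  interpret N: prob_space std_gaussian by (rule prob_space_std_gaussian)
  interpret P: pair_prob_space std_gaussian std_gaussian ..
  have fst: "distr (std_gaussian \<Otimes>\<^sub>M std_gaussian) borel (\<lambda>z. u * fst z) = gaussian (u\<^sup>2)"
  proof -
    have "distr (distr (std_gaussian \<Otimes>\<^sub>M std_gaussian) std_gaussian fst) borel (\<lambda>x. u * x) =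
        distr (std_gaussian \<Otimes>\<^sub>M std_gaussian) borel (\<lambda>z. u * fst z)"
      by (subst distr_distr) (simp_all add: o_def)
    then show ?thesis by (simp add: N.distr_pair_fst gaussian_scale)
  qed
  have snd: "distr (std_gaussian \<Otimes>\<^sub>M std_gaussian) borel (\<lambda>z. v * snd z) = gaussian (v\<^sup>2)"
  proof -
    have "distr (distr (std_gaussian \<Otimes>\<^sub>M std_gaussian) std_gaussian fst) borel (\<lambda>x. v * x) =
        distr (std_gaussian \<Otimes>\<^sub>M std_gaussian) borel (\<lambda>z. v * snd z)"
      by (subst (2) P.distr_pair_swap) (simp add: distr_distr o_def case_prod_beta)
    then show ?thesis by (simp add: N.distr_pair_fst gaussian_scale)
  qed
  show ?thesis
  proof (cases "u = 0 \<or> v = 0")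
    case True
    then show ?thesis
      unfolding case_prod_unfold using fst snd by auto
  next
    case False
    interpret U: prob_space "gaussian (u\<^sup>2)"
      unfolding gaussian_scale[symmetric] by (rule N.prob_space_distr) simp
    interpret V: prob_space "gaussian (v\<^sup>2)"
      unfolding gaussian_scale[symmetric] by (rule N.prob_space_distr) simp
    have "distr (std_gaussian \<Otimes>\<^sub>M std_gaussian) borel (\<lambda>(x, y). u * x + v * y) =
        convolution (gaussian (u\<^sup>2)) (gaussian (v\<^sup>2))"
      unfolding convolution_def gaussian_scale[symmetric]
      apply (subst pair_measure_distr)
      apply simp
      apply simp
      apply (simp add: gaussian_scale V.sigma_finite_measure_axioms)
      apply (subst distr_distr)
      apply (auto intro!: distr_cong)
      done
    also have "\<dots> = gaussian (u\<^sup>2 + v\<^sup>2)"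
      using False U.finite_measure_axioms V.finite_measure_axioms
      by (simp add: gaussian_eq_density sum_power2_gt_zero_iff convolution_density
          conv_normal_density_zero_mean flip: ennreal_mult')
    finally show ?thesis .
  qed
qed

lemma gaussian_pair_linear:
  assumes "\<bar>\<nu>\<bar> \<le> \<rho>"
  shows "distr (gaussian_pair \<rho> \<nu>) borel (\<lambda>(z, z'). a * z + b * z') =
    gaussian (a\<^sup>2 * \<rho> + 2 * a * b * \<nu> + b\<^sup>2 * \<rho>)"
proof -
  define s t where "s = sqrt ((\<rho> + \<nu>) / 2)" and "t = sqrt ((\<rho> - \<nu>) / 2)"
  have st: "s\<^sup>2 = (\<rho> + \<nu>) / 2" "t\<^sup>2 = (\<rho> - \<nu>) / 2"
    using assms by (auto simp: s_def t_def)
  have "distr (gaussian_pair \<rho> \<nu>) borel (\<lambda>(z, z'). a * z + b * z') =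
      distr (std_gaussian \<Otimes>\<^sub>M std_gaussian) borel
        (\<lambda>(x, y). ((a + b) * s) * x + ((a - b) * t) * y)"
    unfolding gaussian_pair_def s_def[symmetric] t_def[symmetric]
    by (subst distr_distr) (auto intro!: distr_cong simp: algebra_simps)
  also have "\<dots> = gaussian (((a + b) * s)\<^sup>2 + ((a - b) * t)\<^sup>2)"
    by (rule std_gaussian_linear)
  also have "((a + b) * s)\<^sup>2 + ((a - b) * t)\<^sup>2 = a\<^sup>2 * \<rho> + 2 * a * b * \<nu> + b\<^sup>2 * \<rho>"
    unfolding power_mult_distrib st by (simp add: power2_eq_square field_simps)
  finally show ?thesis .
qed

lemma alpha_relu_measurable [measurable]: "alpha_relu \<alpha> \<in> borel_measurable borel"
  unfolding alpha_relu_def by measurable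

lemma alpha_relu_scale: "k > 0 \<Longrightarrow> alpha_relu \<alpha> (k * x) = k powr \<alpha> * alpha_relu \<alpha> x"
  by (auto simp: alpha_relu_def powr_mult zero_less_mult_iff)

lemma Vt_alpha_relu:
  assumes "q > 0"
  shows "Vt (alpha_relu \<alpha>) q = q powr \<alpha> * Vt (alpha_relu \<alpha>) 1"
proof -
  have *: "(sqrt q powr \<alpha>)\<^sup>2 = q powr \<alpha>"
    using assms by (simp add: power2_eq_square powr_mult[symmetric])
  show ?thesis
    using assms by (simp add: Vt_def gaussian_def integral_distr alpha_relu_scale power_mult_distrib *)
qed

lemma Wt_alpha_relu:
  assumes "q > 0"
  shows "Wt (alpha_relu \<alpha>) q (c * q) = q powr \<alpha> * Wt (alpha_relu \<alpha>) 1 c"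
proof -
  define k s t where "k = sqrt q" and "s = sqrt ((1 + c) / 2)" and "t = sqrt ((1 - c) / 2)"
  have k: "k > 0" "k powr \<alpha> * k powr \<alpha> = q powr \<alpha>"
    using assms by (simp_all add: k_def powr_mult[symmetric])
  have e: "(q + c * q) / 2 = q * ((1 + c) / 2)" "(q - c * q) / 2 = q * ((1 - c) / 2)"
    by (simp_all add: algebra_simps)
  have st: "sqrt ((q + c * q) / 2) = k * s" "sqrt ((q - c * q) / 2) = k * t"
    unfolding e real_sqrt_mult k_def s_def t_def by simp_all
  have *: "alpha_relu \<alpha> (k * s * x + k * t * y) = k powr \<alpha> * alpha_relu \<alpha> (s * x + t * y)"
      "alpha_relu \<alpha> (k * s * x - k * t * y) = k powr \<alpha> * alpha_relu \<alpha> (s * x - t * y)" for x y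
    using alpha_relu_scale[OF k(1), of \<alpha> "s * x + t * y"]
      alpha_relu_scale[OF k(1), of \<alpha> "s * x - t * y"] by (simp_all add: algebra_simps)
  have "Wt (alpha_relu \<alpha>) q (c * q) = (\<integral>z. alpha_relu \<alpha> (k * s * fst z + k * t * snd z) *
      alpha_relu \<alpha> (k * s * fst z - k * t * snd z) \<partial>(std_gaussian \<Otimes>\<^sub>M std_gaussian))"
    unfolding Wt_def gaussian_pair_def st by (subst integral_distr) (simp_all add: case_prod_beta)
  also have "\<dots> = (\<integral>z. q powr \<alpha> * (alpha_relu \<alpha> (s * fst z + t * snd z) *
      alpha_relu \<alpha> (s * fst z - t * snd z)) \<partial>(std_gaussian \<Otimes>\<^sub>M std_gaussian))"
    unfolding * k(2)[symmetric] by (simp only: mult.assoc mult.left_commute)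
  also have "\<dots> = q powr \<alpha> * Wt (alpha_relu \<alpha>) 1 c"
    unfolding Wt_def gaussian_pair_def s_def[symmetric] t_def[symmetric]
    by (subst integral_distr) (simp_all add: case_prod_beta)
  finally show ?thesis .
qed

lemma JJ_eq: "q > 0 \<Longrightarrow> Wt (alpha_relu \<alpha>) q (c * q) / Vt (alpha_relu \<alpha>) q = JJ \<alpha> c"
  by (simp add: Vt_alpha_relu[of q] Wt_alpha_relu[of q] JJ_def)

lemma Vt_alpha_relu_pos:
  assumes "0 < \<alpha>" "\<alpha> < 1" "0 < q"
  shows "Vt (alpha_relu \<alpha>) q > 0"
proof -
  let ?f = "\<lambda>x. std_normal_density x * (alpha_relu \<alpha> x)\<^sup>2"
  have V: "Vt (alpha_relu \<alpha>) 1 = (\<integral>x. ?f x \<partial>lborel)"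
    by (simp add: Vt_def gaussian_def integral_distr integral_density)
  have bound: "(alpha_relu \<alpha> x)\<^sup>2 \<le> 1 + x\<^sup>2" for x
  proof (cases "x > 0")
    case True
    have "x powr \<alpha> \<le> max 1 x"
    proof (cases "x \<le> 1")
      case True
      with \<open>x > 0\<close> assms show ?thesis using powr_le1[of \<alpha> x] by simp
    next
      case False
      then show ?thesis using powr_mono[of \<alpha> 1 x] assms by simp
    qed
    then have "(x powr \<alpha>)\<^sup>2 \<le> (max 1 x)\<^sup>2" by (intro power_mono) auto
    also have "\<dots> \<le> 1 + x\<^sup>2" by (auto simp: max_def)
    finally show ?thesis using True by (simp add: alpha_relu_def)
  qed (simp add: alpha_relu_def)
  have "integrable lborel (\<lambda>x. std_normal_density x * x ^ 0 + std_normal_density x * x ^ 2)"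
    by (intro Bochner_Integration.integrable_add integrable_std_normal_moment)
  then have int: "integrable lborel ?f"
    by (rule Bochner_Integration.integrable_bound)
      (use mult_left_mono[OF bound normal_density_nonneg[of 0 1]] in
        \<open>auto simp: abs_mult distrib_left\<close>)
  have "(\<integral>x. ?f x \<partial>lborel) \<noteq> 0"
  proof
    assume "(\<integral>x. ?f x \<partial>lborel) = 0"
    then have "AE x in lborel. ?f x = 0"
      using integral_nonneg_eq_0_iff_AE[OF int] by simp
    then have "AE x in lborel. x \<notin> {0<..<1::real}"
      by eventually_elim (auto simp: alpha_relu_def normal_density_def)
    then have "emeasure lborel {0<..<1::real} = 0"
      by (subst (asm) AE_iff_measurable[of "{0<..<1}"]) auto
    then show False by simp
  qed
  moreover have "(\<integral>x. ?f x \<partial>lborel) \<ge> 0" by (intro integral_nonneg_AE) auto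
  ultimately have "Vt (alpha_relu \<alpha>) 1 > 0" unfolding V by linarith
  then show ?thesis using assms by (simp add: Vt_alpha_relu[of q])
qed

(* Without biases a trajectory that starts at a fixed point e of JJ has \<gamma> l / p l = e for all l. *)
lemma frn_mean_field_fixed_ratio:
  assumes "0 < \<alpha>" "\<alpha> < 1" "\<sigma>w \<noteq> 0" "p 0 > 0" "\<gamma> 0 = e * p 0" "JJ \<alpha> e = e"
    and frn: "frn_mean_field (alpha_relu \<alpha>) \<sigma>v 0 \<sigma>w 0 p q \<gamma> lam"
  shows "p l > 0 \<and> \<gamma> l = e * p l"
proof (induction l)
  case 0
  show ?case using assms by simp
next
  case (Suc l)
  let ?V = "Vt (alpha_relu \<alpha>) (q (Suc l))"
  have eqs: "q (Suc l) = \<sigma>w\<^sup>2 * p l" "p (Suc l) = \<sigma>v\<^sup>2 * ?V + p l" "lam (Suc l) = \<sigma>w\<^sup>2 * \<gamma> l"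
    "\<gamma> (Suc l) = \<sigma>v\<^sup>2 * Wt (alpha_relu \<alpha>) (q (Suc l)) (lam (Suc l)) + \<gamma> l"
    using frn[unfolded frn_mean_field_def, rule_format, of "Suc l"] by auto
  have q: "q (Suc l) > 0" using Suc eqs(1) assms(3) by simp
  have V: "?V > 0" using Vt_alpha_relu_pos[OF assms(1,2) q] .
  have "lam (Suc l) = e * q (Suc l)" using Suc eqs by simp
  then have "Wt (alpha_relu \<alpha>) (q (Suc l)) (lam (Suc l)) = e * ?V"
    using JJ_eq[OF q, of \<alpha> e] V assms(6) by (simp add: field_simps)
  then show ?case using Suc eqs(2,4) V by (simp add: algebra_simps add_pos_nonneg)
qed

end

theory Submission
  imports Defs
begin

text \<open>
  Polar coordinates turn the kernel function into
  \<open>J c = I c / I 1\<close> with \<open>I c = \<integral> (c + cos (2 x))\<^sub>+ powr \<alpha> dx\<close> over \<open>{-\<pi>/2..\<pi>/2}\<close>.  An integration by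
  parts relates the exponents \<open>\<alpha>\<close>, \<open>\<alpha> + 1\<close>, \<open>\<alpha> + 2\<close>; since differentiation in \<open>c\<close> lowers the
  exponent, it yields both the smoothness of \<open>J\<close> on \<open>(-1, 1)\<close> and the equation
  \<open>(1 - c\<^sup>2) J'' = \<alpha>\<^sup>2 J - (2 \<alpha> - 1) c J'\<close>.  Hence \<open>J\<close> is strictly convex on \<open>[0, 1]\<close> and drops below
  the diagonal, so that it has exactly one fixed point \<open>e < 1\<close>, and \<open>0 < J' e < 1\<close>.

  After a shift of \<open>p\<close> and \<open>\<gamma>\<close> by \<open>\<sigma>b\<^sup>2 / \<sigma>w\<^sup>2\<close> the recursion reads \<open>P' = P + A P powr \<alpha> + a\<close>,
  \<open>G' = G + A P powr \<alpha> J (G / P) + a\<close>, and \<open>A P powr (\<alpha> - 1)\<close> is asymptotic to \<open>1 / ((1 - \<alpha>) l)\<close>.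
  The difference \<open>D = G - e P\<close> is multiplied by about \<open>1 + J' e / ((1 - \<alpha>) l)\<close> in each step and
  receives the nonnegative term \<open>a (1 - e)\<close>.  As \<open>J\<close> is increasing, \<open>D\<close> grows at the full rate once it
  is positive; and the distance of two trajectories that both keep \<open>D \<le> 0\<close> grows at that
  rate as well, so that the lower of the two has the full rate.  Hence at most one trajectory is
  exceptional.
\<close>

section \<open>The arc integral\<close>

lemma alpha_relu_nonneg: "alpha_relu \<beta> x \<ge> 0"
  by (simp add: alpha_relu_def)

lemma alpha_relu_mono: "0 \<le> \<beta> \<Longrightarrow> x \<le> y \<Longrightarrow> alpha_relu \<beta> x \<le> alpha_relu \<beta> y"
  by (auto simp: alpha_relu_def intro: powr_mono2)

lemma alpha_relu_Suc: "alpha_relu (\<beta> + 1) x = x * alpha_relu \<beta> x"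
  by (auto simp: alpha_relu_def powr_add)

text \<open>The sign condition excludes two negative arguments, whose product is positive although
  both factors on the left vanish.\<close>

lemma alpha_relu_mult:
  "x + y \<ge> 0 \<Longrightarrow> alpha_relu \<beta> x * alpha_relu \<beta> y = alpha_relu \<beta> (x * y)"
  by (auto simp: alpha_relu_def powr_mult zero_less_mult_iff)

lemma continuous_on_alpha_relu:
  assumes "0 < \<beta>" "continuous_on S f"
  shows "continuous_on S (\<lambda>x. alpha_relu \<beta> (f x))"
proof -
  have "continuous_on S (\<lambda>x. max 0 (f x) powr \<beta>)"
    using assms by (intro continuous_on_powr' continuous_intros) auto
  also have "(\<lambda>x. max 0 (f x) powr \<beta>) = (\<lambda>x. alpha_relu \<beta> (f x))"
    using assms by (auto simp: alpha_relu_def max_def fun_eq_iff)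
  finally show ?thesis .
qed

lemma isCont_alpha_relu: "0 < \<beta> \<Longrightarrow> isCont f x \<Longrightarrow> isCont (\<lambda>x. alpha_relu \<beta> (f x)) x"
  using continuous_on_alpha_relu[of \<beta> UNIV "\<lambda>x. x"]
  by (auto simp: continuous_on_eq_continuous_at intro: isCont_o2)

lemma has_field_derivative_alpha_relu:
  assumes "0 < \<beta>"
  shows "(alpha_relu (\<beta> + 1) has_field_derivative (\<beta> + 1) * alpha_relu \<beta> x) (at x)"
proof -
  consider "x > 0" | "x < 0" | "x = 0" by linarith
  then show ?thesis
  proof cases
    case 1
    then have "((\<lambda>x. x powr (\<beta> + 1)) has_field_derivative (\<beta> + 1) * alpha_relu \<beta> x) (at x)"
      using assms by (auto intro!: derivative_eq_intros simp: alpha_relu_def)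
    then show ?thesis
      by (rule has_field_derivative_transform_within_open[of _ _ _ "{0<..}"])
        (use 1 in \<open>auto simp: alpha_relu_def\<close>)
  next
    case 2
    have "((\<lambda>x. 0) has_field_derivative (\<beta> + 1) * alpha_relu \<beta> x) (at x)"
      using 2 by (auto intro!: derivative_eq_intros simp: alpha_relu_def)
    then show ?thesis
      by (rule has_field_derivative_transform_within_open[of _ _ _ "{..<0}"])
        (use 2 in \<open>auto simp: alpha_relu_def\<close>)
  next
    case 3
    have "isCont (alpha_relu \<beta>) 0" using isCont_alpha_relu[OF assms, where f = "\<lambda>x. x"] by simp
    then have "alpha_relu \<beta> \<midarrow>0\<rightarrow> 0" by (simp add: isCont_def alpha_relu_def)
    \<comment> \<open>By \<open>alpha_relu_Suc\<close> the difference quotient at 0 is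
      \<open>alpha_relu \<beta> h\<close>, so continuity of the lower power at 0 yields the
      limit.\<close>
    then have "(\<lambda>h. (alpha_relu (\<beta> + 1) (0 + h) - alpha_relu (\<beta> + 1) 0) / h) \<midarrow>0\<rightarrow> 0"
      by (rule Lim_transform_eventually)
        (auto simp: eventually_at_filter alpha_relu_Suc intro!: always_eventually)
    then show ?thesis unfolding DERIV_def 3 by (simp add: alpha_relu_def)
  qed
qed

text \<open>Here x is the polar angle of the two independent normals behind
  \<open>gaussian_pair 1 c\<close>. For \<bar>c\<bar> \<le> 1 the integrand is positive exactly
  where both coordinates of the pair are.\<close>

definition arc_integral :: "real \<Rightarrow> real \<Rightarrow> real" where
  "arc_integral \<beta> c = integral {-(pi/2)..pi/2} (\<lambda>x. alpha_relu \<beta> (c + cos (2 * x)))"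

text \<open>Leibniz's rule is applied with an exponent above 1, where the integrand is continuously
  differentiable across the zeros of c + cos (2 x). The kernel exponent \<alpha> < 1 is out of its
  reach; \<open>arc_integral_recurrence\<close> bridges the gap.\<close>

lemma arc_integral_has_field_derivative:
  assumes "0 < \<beta>"
  shows "(arc_integral (\<beta> + 1) has_field_derivative (\<beta> + 1) * arc_integral \<beta> c) (at c within S)"
proof -
  have "((\<lambda>c. integral (cbox (-(pi/2)) (pi/2)) (\<lambda>x. alpha_relu (\<beta> + 1) (c + cos (2 * x))))
    has_field_derivative
    integral (cbox (-(pi/2)) (pi/2)) (\<lambda>x. (\<beta> + 1) * alpha_relu \<beta> (c + cos (2 * x)))) (at c within UNIV)"
  proof (rule leibniz_rule_field_derivative)
    show "((\<lambda>c. alpha_relu (\<beta> + 1) (c + cos (2 * x))) has_field_derivative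
        (\<beta> + 1) * alpha_relu \<beta> (c + cos (2 * x))) (at c within UNIV)" for c x :: real
      by (rule DERIV_chain2[OF has_field_derivative_alpha_relu[OF assms], of _ 1, simplified])
        (auto intro!: derivative_eq_intros)
    show "(\<lambda>x. alpha_relu (\<beta> + 1) (c + cos (2 * x))) integrable_on cbox (-(pi/2)) (pi/2)" for c
      using assms by (intro integrable_continuous continuous_on_alpha_relu continuous_intros) auto
    show "continuous_on (UNIV \<times> cbox (-(pi/2)) (pi/2))
       (\<lambda>(c, x). (\<beta> + 1) * alpha_relu \<beta> (c + cos (2 * x)))"
      unfolding case_prod_beta using assms
      by (intro continuous_on_alpha_relu continuous_intros) auto
  qed auto
  then have "(arc_integral (\<beta> + 1) has_field_derivative (\<beta> + 1) * arc_integral \<beta> c) (at c)"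
    by (simp add: arc_integral_def[abs_def])
  then show ?thesis by (rule has_field_derivative_at_within)
qed

lemma continuous_on_arc_integral:
  assumes "0 < \<beta>" shows "continuous_on S (arc_integral \<beta>)"
proof -
  have "continuous_on S (\<lambda>c. integral (cbox (-(pi/2)) (pi/2)) (\<lambda>x. alpha_relu \<beta> (c + cos (2 * x))))"
    unfolding case_prod_beta using assms
    by (intro integral_continuous_on_param, unfold case_prod_beta,
        intro continuous_on_alpha_relu continuous_intros)
  then show ?thesis by (simp add: arc_integral_def[abs_def])
qed

lemma arc_integral_integrable:
  "0 < \<beta> \<Longrightarrow> (\<lambda>x. alpha_relu \<beta> (c + cos (2 * x))) integrable_on {-(pi/2)..pi/2}"
  by (intro integrable_continuous_interval continuous_on_alpha_relu continuous_intros)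

lemma arc_integral_nonneg: "arc_integral \<beta> c \<ge> 0"
  \<comment> \<open>For \<beta> \<le> 0 integrability may fail; the integral is then 0 by
    convention.\<close>
  unfolding arc_integral_def by (cases "(\<lambda>x. alpha_relu \<beta> (c + cos (2 * x))) integrable_on {-(pi/2)..pi/2}")
   (auto intro!: integral_nonneg alpha_relu_nonneg simp: not_integrable_integral)

lemma arc_integral_mono: "0 < \<beta> \<Longrightarrow> c \<le> d \<Longrightarrow> arc_integral \<beta> c \<le> arc_integral \<beta> d"
  unfolding arc_integral_def
  by (intro integral_le arc_integral_integrable alpha_relu_mono) auto

text \<open>A continuous nonnegative integrand with zero integral vanishes everywhere, but at x = 0
  its value is \<open>(c + 1) powr \<beta>\<close>.\<close>

lemma arc_integral_pos:
  assumes "0 < \<beta>" "0 \<le> c" shows "arc_integral \<beta> c > 0"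
proof -
  have "arc_integral \<beta> c \<noteq> 0"
  proof
    assume "arc_integral \<beta> c = 0"
    then have "((\<lambda>x. alpha_relu \<beta> (c + cos (2 * x))) has_integral 0) (cbox (-(pi/2)) (pi/2))"
      using arc_integral_integrable[OF assms(1), of c] unfolding arc_integral_def
      by (metis cbox_interval integrable_integral)
    then have "alpha_relu \<beta> (c + cos (2 * 0)) = 0"
      by (intro has_integral_0_cbox_imp_0[where f = "\<lambda>x. alpha_relu \<beta> (c + cos (2 * x))" and x = 0])
       (use pi_gt_zero in \<open>auto intro!: continuous_on_alpha_relu continuous_intros alpha_relu_nonneg
          simp: assms simp del: pi_gt_zero\<close>)
    then show False using assms by (simp add: alpha_relu_def split: if_splits)
  qed
  then show ?thesis using arc_integral_nonneg[of \<beta> c] by linarith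
qed

text \<open>Integrating the derivative of \<open>sin (2 x) * alpha_relu (\<beta> + 1) (c + cos (2 x))\<close>.\<close>
lemma arc_integral_recurrence:
  assumes "0 < \<beta>"
  shows "(\<beta> + 2) * arc_integral (\<beta> + 2) c =
    (2 * \<beta> + 3) * c * arc_integral (\<beta> + 1) c + (\<beta> + 1) * (1 - c\<^sup>2) * arc_integral \<beta> c"
proof -
  let ?r = "\<lambda>\<beta> x. alpha_relu \<beta> (c + cos (2 * x))"
  let ?S = "{-(pi/2)..pi/2}"
  have r: "?r (\<beta> + 1) x = (c + cos (2 * x)) * ?r \<beta> x" "?r (\<beta> + 2) x = (c + cos (2 * x))\<^sup>2 * ?r \<beta> x" for x
    using alpha_relu_Suc[of \<beta>] alpha_relu_Suc[of "\<beta> + 1"] by (simp_all add: power2_eq_square add.assoc)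
  have "((\<lambda>x. 2 * ((\<beta> + 2) * ?r (\<beta> + 2) x - (2 * \<beta> + 3) * c * ?r (\<beta> + 1) x - (\<beta> + 1) * (1 - c\<^sup>2) * ?r \<beta> x))
     has_integral (sin (2 * (pi/2)) * ?r (\<beta> + 1) (pi/2) - sin (2 * (-(pi/2))) * ?r (\<beta> + 1) (-(pi/2)))) ?S"
  proof (rule fundamental_theorem_of_calculus)
    fix x :: real
    have "((\<lambda>x. ?r (\<beta> + 1) x) has_field_derivative ((\<beta> + 1) * ?r \<beta> x) * (- sin (2 * x) * 2)) (at x within ?S)"
      by (rule DERIV_chain2[OF has_field_derivative_alpha_relu[OF assms]])
        (auto intro!: derivative_eq_intros)
    then have "((\<lambda>x. sin (2 * x) * ?r (\<beta> + 1) x) has_field_derivative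
      sin (2 * x) * (((\<beta> + 1) * ?r \<beta> x) * (- sin (2 * x) * 2)) + cos (2 * x) * 2 * ?r (\<beta> + 1) x) (at x within ?S)"
      by (auto intro!: derivative_eq_intros)
    also have "sin (2 * x) * (((\<beta> + 1) * ?r \<beta> x) * (- sin (2 * x) * 2)) + cos (2 * x) * 2 * ?r (\<beta> + 1) x
       = 2 * (cos (2 * x) * ?r (\<beta> + 1) x - (\<beta> + 1) * (sin (2 * x))\<^sup>2 * ?r \<beta> x)"
      by (simp add: power2_eq_square algebra_simps)
    \<comment> \<open>Writing sin^2 as 1 - cos^2 and cos (2 x) as (c + cos (2 x)) - c leaves only
      powers of c + cos (2 x).\<close>
    also have "\<dots> = 2 * ((\<beta> + 2) * ?r (\<beta> + 2) x - (2 * \<beta> + 3) * c * ?r (\<beta> + 1) x - (\<beta> + 1) * (1 - c\<^sup>2) * ?r \<beta> x)"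
      unfolding sin_squared_eq r by (simp add: power2_eq_square algebra_simps)
    finally show "((\<lambda>x. sin (2 * x) * ?r (\<beta> + 1) x) has_vector_derivative 
      2 * ((\<beta> + 2) * ?r (\<beta> + 2) x - (2 * \<beta> + 3) * c * ?r (\<beta> + 1) x - (\<beta> + 1) * (1 - c\<^sup>2) * ?r \<beta> x)) (at x within ?S)"
      by (simp add: has_real_derivative_iff_has_vector_derivative)
  qed simp
  moreover have "((\<lambda>x. 2 * ((\<beta> + 2) * ?r (\<beta> + 2) x - (2 * \<beta> + 3) * c * ?r (\<beta> + 1) x - (\<beta> + 1) * (1 - c\<^sup>2) * ?r \<beta> x))
     has_integral 2 * ((\<beta> + 2) * arc_integral (\<beta> + 2) c - (2 * \<beta> + 3) * c * arc_integral (\<beta> + 1) c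
        - (\<beta> + 1) * (1 - c\<^sup>2) * arc_integral \<beta> c)) ?S"
    unfolding arc_integral_def using assms
    by (intro has_integral_mult_right has_integral_diff integrable_integral arc_integral_integrable) auto
  \<comment> \<open>The boundary terms vanish because sin (2 x) is 0 at both ends.\<close>
  ultimately show ?thesis by (auto dest: has_integral_unique)
qed

section \<open>The kernel function and its nonunit fixed point\<close>

definition arc_kernel :: "real \<Rightarrow> real \<Rightarrow> real" where
  "arc_kernel \<alpha> c = arc_integral \<alpha> c / arc_integral \<alpha> 1"

text \<open>The derivative on (-1, 1), found by solving \<open>arc_integral_recurrence\<close> for
  \<open>arc_integral \<alpha>\<close> and differentiating the quotient.\<close>

definition arc_kernel' :: "real \<Rightarrow> real \<Rightarrow> real" where
  "arc_kernel' \<alpha> c = ((\<alpha> + 1) * arc_integral (\<alpha> + 1) c - (2 * \<alpha> + 1) * c * arc_integral \<alpha> c) /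
     (1 - c\<^sup>2) / arc_integral \<alpha> 1"

definition arc_kernel'' :: "real \<Rightarrow> real \<Rightarrow> real" where
  "arc_kernel'' \<alpha> c = (\<alpha>\<^sup>2 * arc_kernel \<alpha> c - (2 * \<alpha> - 1) * c * arc_kernel' \<alpha> c) / (1 - c\<^sup>2)"

lemma one_minus_square_pos: "\<bar>c\<bar> < 1 \<Longrightarrow> 1 - c\<^sup>2 > (0::real)"
  by (simp add: abs_square_less_1)

lemma arc_kernel_has_derivative:
  assumes "0 < \<alpha>" "\<bar>c\<bar> < 1"
  shows "(arc_kernel \<alpha> has_field_derivative arc_kernel' \<alpha> c) (at c)"
proof -
  let ?I = "arc_integral \<alpha>" and ?I1 = "arc_integral (\<alpha> + 1)" and ?I2 = "arc_integral (\<alpha> + 2)"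
  let ?N = "\<lambda>c. (\<alpha> + 2) * ?I2 c - (2 * \<alpha> + 3) * c * ?I1 c" and ?w = "\<lambda>c::real. (\<alpha> + 1) * (1 - c\<^sup>2)"
  have N: "?N c = ?w c * ?I c" for c
    using arc_integral_recurrence[OF assms(1), of c] by simp
  have w: "?w c \<noteq> 0" if "\<bar>c\<bar> < 1" for c
    using one_minus_square_pos[OF that] assms by simp
  have D1: "(?I1 has_field_derivative (\<alpha> + 1) * ?I c) (at c)"
    using arc_integral_has_field_derivative[OF assms(1)] .
  have D2: "(?I2 has_field_derivative (\<alpha> + 2) * ?I1 c) (at c)"
    using arc_integral_has_field_derivative[of "\<alpha> + 1" c UNIV] assms(1) by (simp add: add.assoc)
  have "((\<lambda>c. ?N c / ?w c) has_field_derivative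
     (((\<alpha> + 2) * ((\<alpha> + 2) * ?I1 c) - (2 * \<alpha> + 3) * (?I1 c + c * ((\<alpha> + 1) * ?I c))) * ?w c
       - ?N c * (- 2 * c * (\<alpha> + 1))) / (?w c * ?w c)) (at c)"
    by (rule derivative_eq_intros D1 D2 w[OF assms(2)] refl)+
      (simp add: algebra_simps)
  \<comment> \<open>Inserting N = w I cancels one power of w and removes
    \<open>arc_integral (\<alpha> + 2)\<close>.\<close>
  also have "(((\<alpha> + 2) * ((\<alpha> + 2) * ?I1 c) - (2 * \<alpha> + 3) * (?I1 c + c * ((\<alpha> + 1) * ?I c))) * ?w c
       - ?N c * (- 2 * c * (\<alpha> + 1))) / (?w c * ?w c) =
     (((\<alpha> + 2) * ((\<alpha> + 2) * ?I1 c) - (2 * \<alpha> + 3) * (?I1 c + c * ((\<alpha> + 1) * ?I c)))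
       + 2 * c * (\<alpha> + 1) * ?I c) / ?w c"
    unfolding N using w[OF assms(2)] by (simp add: divide_simps) (simp add: algebra_simps)
  also have "\<dots> = ((\<alpha> + 1) * ((\<alpha> + 1) * ?I1 c - (2 * \<alpha> + 1) * c * ?I c)) / ?w c"
    by (simp add: algebra_simps)
  also have "\<dots> = ((\<alpha> + 1) * ?I1 c - (2 * \<alpha> + 1) * c * ?I c) / (1 - c\<^sup>2)"
    using assms(1) by simp
  finally have "(?I has_field_derivative ((\<alpha> + 1) * ?I1 c - (2 * \<alpha> + 1) * c * ?I c) / (1 - c\<^sup>2)) (at c)"
    by (rule has_field_derivative_transform_within_open[of _ _ _ "{-1<..<1}"])
      (use assms(2) w in \<open>auto simp: N abs_less_iff\<close>)
  then show ?thesis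
    unfolding arc_kernel_def[abs_def] arc_kernel'_def by (rule DERIV_cdivide)
qed

text \<open>The numerator of \<open>arc_kernel'\<close> is built from functions already known to be
  differentiable, and the same cancellation as before turns the quotient rule into the second-order
  equation.\<close>

lemma arc_kernel'_has_derivative:
  assumes "0 < \<alpha>" "\<bar>c\<bar> < 1"
  shows "(arc_kernel' \<alpha> has_field_derivative arc_kernel'' \<alpha> c) (at c)"
proof -
  let ?K = "arc_kernel \<alpha>" and ?K' = "arc_kernel' \<alpha>" and ?K1 = "\<lambda>c. arc_integral (\<alpha> + 1) c / arc_integral \<alpha> 1"
  let ?N = "\<lambda>c. (\<alpha> + 1) * ?K1 c - (2 * \<alpha> + 1) * c * ?K c"
  have K': "?K' = (\<lambda>c. ?N c / (1 - c\<^sup>2))"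
    by (auto simp: fun_eq_iff arc_kernel'_def arc_kernel_def diff_divide_distrib mult.commute)
  have w: "1 - c\<^sup>2 \<noteq> 0" using one_minus_square_pos[OF assms(2)] by simp
  have N: "?N c = (1 - c\<^sup>2) * ?K' c" unfolding K' using w by simp
  have D1: "(?K1 has_field_derivative (\<alpha> + 1) * ?K c) (at c)"
    unfolding arc_kernel_def times_divide_eq_right
    by (intro DERIV_cdivide arc_integral_has_field_derivative assms)
  have "((\<lambda>c. ?N c / (1 - c\<^sup>2)) has_field_derivative
     (((\<alpha> + 1) * ((\<alpha> + 1) * ?K c) - (2 * \<alpha> + 1) * (?K c + c * ?K' c)) * (1 - c\<^sup>2)
       - ?N c * (- 2 * c)) / ((1 - c\<^sup>2) * (1 - c\<^sup>2))) (at c)"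
    by (rule derivative_eq_intros D1 arc_kernel_has_derivative assms w refl)+
      (simp add: algebra_simps)
  also have "(((\<alpha> + 1) * ((\<alpha> + 1) * ?K c) - (2 * \<alpha> + 1) * (?K c + c * ?K' c)) * (1 - c\<^sup>2)
       - ?N c * (- 2 * c)) / ((1 - c\<^sup>2) * (1 - c\<^sup>2)) =
     (((\<alpha> + 1) * ((\<alpha> + 1) * ?K c) - (2 * \<alpha> + 1) * (?K c + c * ?K' c)) + 2 * c * ?K' c) / (1 - c\<^sup>2)"
    unfolding N using w by (simp add: divide_simps) (simp add: algebra_simps)
  also have "\<dots> = arc_kernel'' \<alpha> c"
    by (simp add: arc_kernel''_def power2_eq_square algebra_simps)
  finally show ?thesis unfolding K' .
qed

text \<open>Differentiating the second-order equation once more eliminates the kernel itself: what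
  remains is a first-order linear equation for \<open>arc_kernel''\<close> whose source is a
  nonnegative multiple of \<open>arc_kernel'\<close>.\<close>

lemma arc_kernel''_has_derivative:
  assumes "0 < \<alpha>" "\<bar>c\<bar> < 1"
  shows "(arc_kernel'' \<alpha> has_field_derivative
    ((3 - 2 * \<alpha>) * c * arc_kernel'' \<alpha> c + (1 - \<alpha>)\<^sup>2 * arc_kernel' \<alpha> c) / (1 - c\<^sup>2)) (at c)"
proof -
  let ?K = "arc_kernel \<alpha>" and ?K' = "arc_kernel' \<alpha>" and ?K'' = "arc_kernel'' \<alpha>"
  let ?N = "\<lambda>c. \<alpha>\<^sup>2 * ?K c - (2 * \<alpha> - 1) * c * ?K' c"
  have w: "1 - c\<^sup>2 \<noteq> 0" using one_minus_square_pos[OF assms(2)] by simp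
  have N: "?N c = (1 - c\<^sup>2) * ?K'' c" unfolding arc_kernel''_def using w by simp
  have "((\<lambda>c. ?N c / (1 - c\<^sup>2)) has_field_derivative
     ((\<alpha>\<^sup>2 * ?K' c - (2 * \<alpha> - 1) * (?K' c + c * ?K'' c)) * (1 - c\<^sup>2)
       - ?N c * (- 2 * c)) / ((1 - c\<^sup>2) * (1 - c\<^sup>2))) (at c)"
    by (rule derivative_eq_intros arc_kernel'_has_derivative arc_kernel_has_derivative assms w refl)+
      (simp add: algebra_simps)
  also have "((\<alpha>\<^sup>2 * ?K' c - (2 * \<alpha> - 1) * (?K' c + c * ?K'' c)) * (1 - c\<^sup>2)
       - ?N c * (- 2 * c)) / ((1 - c\<^sup>2) * (1 - c\<^sup>2)) =
     ((\<alpha>\<^sup>2 * ?K' c - (2 * \<alpha> - 1) * (?K' c + c * ?K'' c)) + 2 * c * ?K'' c) / (1 - c\<^sup>2)"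
    unfolding N using w by (simp add: divide_simps) (simp add: algebra_simps)
  also have "\<dots> = ((3 - 2 * \<alpha>) * c * ?K'' c + (1 - \<alpha>)\<^sup>2 * ?K' c) / (1 - c\<^sup>2)"
    by (simp add: power2_eq_square algebra_simps)
  finally show ?thesis unfolding arc_kernel''_def[abs_def] .
qed

section \<open>Convexity on [0, 1] and the fixed point\<close>

context
  fixes \<alpha> :: real
  assumes \<alpha>: "0 < \<alpha>" "\<alpha> < 1"
begin

lemma arc_kernel_one: "arc_kernel \<alpha> 1 = 1"
  using arc_integral_pos[of \<alpha> 1] \<alpha> by (simp add: arc_kernel_def)

lemma arc_kernel_mono: "c \<le> d \<Longrightarrow> arc_kernel \<alpha> c \<le> arc_kernel \<alpha> d"
  unfolding arc_kernel_def using \<alpha> arc_integral_mono[of \<alpha> c d] arc_integral_nonneg[of \<alpha> 1]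
  by (intro divide_right_mono) auto

lemma arc_kernel_nonneg: "arc_kernel \<alpha> c \<ge> 0"
  unfolding arc_kernel_def by (intro divide_nonneg_nonneg arc_integral_nonneg)

lemma arc_kernel_pos: "c \<ge> 0 \<Longrightarrow> arc_kernel \<alpha> c > 0"
  unfolding arc_kernel_def using \<alpha> by (intro divide_pos_pos arc_integral_pos) auto

lemma continuous_on_arc_kernel: "continuous_on S (arc_kernel \<alpha>)"
  unfolding arc_kernel_def[abs_def] using \<alpha> arc_integral_pos[of \<alpha> 1]
  by (intro continuous_intros continuous_on_arc_integral) auto

lemma arc_kernel'_nonneg:
  assumes "\<bar>c\<bar> < 1" shows "arc_kernel' \<alpha> c \<ge> 0"
  by (rule mono_on_imp_deriv_nonneg[where A = UNIV, OF _ arc_kernel_has_derivative])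
    (use assms \<alpha> arc_kernel_mono in \<open>auto intro!: mono_onI\<close>)

text \<open>\<open>(1 - c\<^sup>2) powr ((3 - 2 * \<alpha>) / 2)\<close> is an integrating factor of the third-order equation.\<close>
lemma arc_kernel''_pos:
  assumes "0 \<le> c" "c < 1" shows "arc_kernel'' \<alpha> c > 0"
proof -
  define m where "m = (3 - 2 * \<alpha>) / 2"
  let ?y = "\<lambda>c. arc_kernel'' \<alpha> c * (1 - c\<^sup>2) powr m"
  have "?y 0 \<le> ?y c"
  proof (rule DERIV_nonneg_imp_nondecreasing[OF assms(1)])
    fix x assume x: "0 \<le> x" "x \<le> c"
    with assms have x1: "\<bar>x\<bar> < 1" by simp
    note w = one_minus_square_pos[OF x1]
    have "(?y has_real_derivative ((3 - 2 * \<alpha>) * x * arc_kernel'' \<alpha> x + (1 - \<alpha>)\<^sup>2 * arc_kernel' \<alpha> x) / (1 - x\<^sup>2)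
       * (1 - x\<^sup>2) powr m + m * (1 - x\<^sup>2) powr (m - 1) * (- 2 * x) * arc_kernel'' \<alpha> x) (at x)"
      by (rule derivative_eq_intros arc_kernel''_has_derivative \<alpha> x1 w refl)+ simp
    also have "(1 - x\<^sup>2) powr m = (1 - x\<^sup>2) * (1 - x\<^sup>2) powr (m - 1)"
      using w by (simp add: powr_diff)
    \<comment> \<open>As 2 m = 3 - 2 \<alpha>, the terms in \<open>arc_kernel''\<close> cancel and
      only the nonnegative source is left.\<close>
    also have "((3 - 2 * \<alpha>) * x * arc_kernel'' \<alpha> x + (1 - \<alpha>)\<^sup>2 * arc_kernel' \<alpha> x) / (1 - x\<^sup>2)
       * ((1 - x\<^sup>2) * (1 - x\<^sup>2) powr (m - 1)) + m * (1 - x\<^sup>2) powr (m - 1) * (- 2 * x) * arc_kernel'' \<alpha> x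
       = (1 - x\<^sup>2) powr (m - 1) * ((1 - \<alpha>)\<^sup>2 * arc_kernel' \<alpha> x)"
      using w by (simp add: m_def) (simp add: algebra_simps)
    finally show "\<exists>y. (?y has_real_derivative y) (at x) \<and> 0 \<le> y"
      using arc_kernel'_nonneg[OF x1] by (intro exI[of _ "(1 - x\<^sup>2) powr (m - 1) * ((1 - \<alpha>)\<^sup>2 * arc_kernel' \<alpha> x)"] conjI) auto
  qed
  \<comment> \<open>At 0 the first-derivative term of the equation drops out, leaving \<alpha>^2
    times the kernel.\<close>
  moreover have "?y 0 > 0"
    using \<alpha> arc_kernel_pos[of 0] by (simp add: arc_kernel''_def)
  ultimately have "0 < ?y c" by linarith
  then show ?thesis by (simp add: zero_less_mult_iff split: if_splits)
qed

lemma arc_kernel'_strict_mono: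
  assumes "0 \<le> c" "c < d" "d < 1" shows "arc_kernel' \<alpha> c < arc_kernel' \<alpha> d"
  by (rule DERIV_pos_imp_increasing[OF assms(2)])
    (use assms \<alpha> in \<open>auto intro!: exI arc_kernel'_has_derivative arc_kernel''_pos\<close>)

lemma arc_kernel'_pos:
  assumes "0 \<le> c" "c < 1" shows "arc_kernel' \<alpha> c > 0"
proof -
  have "arc_kernel' \<alpha> 0 > 0"
    using \<alpha> arc_integral_pos[of \<alpha> 1] arc_integral_pos[of "\<alpha> + 1" 0] by (simp add: arc_kernel'_def)
  then show ?thesis using arc_kernel'_strict_mono[of 0 c] assms by (cases "c = 0") auto
qed

text \<open>The endpoint d = 1 is included, where continuity suffices: chords ending at the fixed
  point 1 are what the convexity arguments compare.\<close>

lemma arc_kernel_MVT: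
  assumes "0 \<le> c" "c < d" "d \<le> 1"
  obtains z where "c < z" "z < d" "arc_kernel \<alpha> d - arc_kernel \<alpha> c = (d - c) * arc_kernel' \<alpha> z"
proof -
  have "\<exists>l z. c < z \<and> z < d \<and> (arc_kernel \<alpha> has_real_derivative l) (at z) \<and>
      arc_kernel \<alpha> d - arc_kernel \<alpha> c = (d - c) * l"
    by (rule MVT[OF assms(2) continuous_on_arc_kernel])
      (use assms \<alpha> in \<open>auto simp: real_differentiable_def intro!: exI arc_kernel_has_derivative\<close>)
  then obtain l z where z: "c < z" "z < d" "(arc_kernel \<alpha> has_real_derivative l) (at z)"
      "arc_kernel \<alpha> d - arc_kernel \<alpha> c = (d - c) * l" by blast
  have "l = arc_kernel' \<alpha> z"
    by (rule DERIV_unique[OF z(3)] arc_kernel_has_derivative)+ (use z \<alpha> assms in auto)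
  with z that show ?thesis by blast
qed

text \<open>If the kernel stayed above the diagonal, then its derivative would be at most 1, and its
  differential equation would make the second derivative at least of order \<open>1 / (1 - c)\<close>.\<close>
lemma arc_kernel_below_diagonal:
  obtains c where "0 < c" "c < 1" "arc_kernel \<alpha> c < c"
proof (rule ccontr)
  note below = that
  assume not_thesis: "\<not> thesis"
  have K: "arc_kernel \<alpha> c \<ge> c" if "0 < c" "c < 1" for c
    using not_thesis that below by force
  \<comment> \<open>The chord from c to 1 has slope at most 1, and \<open>arc_kernel'\<close>
    increases.\<close>
  have K': "arc_kernel' \<alpha> c \<le> 1" if c: "0 < c" "c < 1" for c
  proof -
    obtain z where z: "c < z" "z < 1" "1 - arc_kernel \<alpha> c = (1 - c) * arc_kernel' \<alpha> z"
      using arc_kernel_MVT[of c 1] c by (auto simp: arc_kernel_one)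
    then have "(1 - c) * arc_kernel' \<alpha> z \<le> (1 - c) * 1" unfolding z(3)[symmetric] using K[OF c] by simp
    then have "arc_kernel' \<alpha> z \<le> 1" by (rule mult_left_le_imp_le) (use c in simp)
    then show ?thesis using arc_kernel'_strict_mono[of c z] z c by simp
  qed
  \<comment> \<open>\<alpha>^2 serves 2 \<alpha> \<le> 1, where the term in J' helps; otherwise J c
    \<ge> c and J' c \<le> 1 leave \<alpha>^2 c - (2 \<alpha> - 1) c = (1 - \<alpha>)^2 c.\<close>
  define m where "m = min (\<alpha>\<^sup>2) ((1 - \<alpha>)\<^sup>2)"
  have m: "m > 0" using \<alpha> by (simp add: m_def)
  have K'': "arc_kernel'' \<alpha> c \<ge> m / 3 / (1 - c)" if c: "1 / 2 \<le> c" "c < 1" for c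
  proof -
    have "m * c \<le> \<alpha>\<^sup>2 * arc_kernel \<alpha> c - (2 * \<alpha> - 1) * c * arc_kernel' \<alpha> c"
    proof (cases "2 * \<alpha> - 1 \<le> 0")
      case True
      have "m * c \<le> \<alpha>\<^sup>2 * arc_kernel \<alpha> c"
        using c K[of c] by (intro mult_mono) (auto simp: m_def)
      moreover have "(2 * \<alpha> - 1) * c * arc_kernel' \<alpha> c \<le> 0"
        using True c arc_kernel'_nonneg[of c] by (intro mult_nonpos_nonneg) auto
      ultimately show ?thesis by linarith
    next
      case False
      have "m * c \<le> (1 - \<alpha>)\<^sup>2 * c" using c by (intro mult_right_mono) (auto simp: m_def)
      also have "\<dots> = \<alpha>\<^sup>2 * c - (2 * \<alpha> - 1) * c * 1" by (simp add: power2_eq_square algebra_simps)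
      also have "\<dots> \<le> \<alpha>\<^sup>2 * arc_kernel \<alpha> c - (2 * \<alpha> - 1) * c * arc_kernel' \<alpha> c"
        using K[of c] K'[of c] c False by (intro diff_mono mult_left_mono) auto
      finally show ?thesis .
    qed
    then have "m * c / (1 - c\<^sup>2) \<le> arc_kernel'' \<alpha> c"
      unfolding arc_kernel''_def using one_minus_square_pos[of c] c by (intro divide_right_mono) auto
    moreover have "m * c / (1 - c\<^sup>2) = m * (c / (1 + c)) / (1 - c)"
    proof -
      have "1 - c\<^sup>2 = (1 + c) * (1 - c)" by (simp add: power2_eq_square algebra_simps)
      then show ?thesis by simp
    qed
    \<comment> \<open>The 3 comes from c / (1 + c) \<ge> 1 / 3 for c \<ge> 1 / 2.\<close>
    moreover have "m * (1 / 3) / (1 - c) \<le> m * (c / (1 + c)) / (1 - c)"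
      using c m by (intro divide_right_mono mult_left_mono) (auto simp: field_simps)
    ultimately show ?thesis by simp
  qed
  \<comment> \<open>Chosen so that integrating m / 3 / (1 - x) from 1 / 2 to c gives m / 3 * (3 / m
    + 1) > 1, more than a derivative with values in [0, 1] can gain.\<close>
  define c where "c = 1 - exp (- 3 / m - 1) / 2"
  have "exp (- 3 / m - 1) < 1" using m by (simp add: field_simps)
  then have c: "1 / 2 \<le> c" "c < 1" by (auto simp: c_def)
  let ?h = "\<lambda>c. arc_kernel' \<alpha> c + m / 3 * ln (1 - c)"
  have "?h (1 / 2) \<le> ?h c"
  proof (rule DERIV_nonneg_imp_nondecreasing[OF c(1)])
    fix x assume x: "1 / 2 \<le> x" "x \<le> c"
    then have "((\<lambda>c. ln (1 - c)) has_real_derivative - (1 / (1 - x))) (at x)"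
      using c by (auto intro!: derivative_eq_intros)
    then have "(?h has_real_derivative arc_kernel'' \<alpha> x + m / 3 * - (1 / (1 - x))) (at x)"
      using x c \<alpha> by (intro DERIV_add DERIV_cmult arc_kernel'_has_derivative) auto
    then show "\<exists>y. (?h has_real_derivative y) (at x) \<and> 0 \<le> y"
      using K''[of x] x c by (intro exI[of _ "arc_kernel'' \<alpha> x + m / 3 * - (1 / (1 - x))"] conjI) auto
  qed
  moreover have "ln (1 - c) = ln (1 / 2) - 3 / m - 1"
    by (simp add: c_def ln_div)
  ultimately have "arc_kernel' \<alpha> (1 / 2) + m / 3 * (3 / m + 1) \<le> arc_kernel' \<alpha> c"
    by (simp add: algebra_simps)
  moreover have "m / 3 * (3 / m + 1) > 1" using m by (simp add: field_simps)
  ultimately have "arc_kernel' \<alpha> c > 1" using arc_kernel'_nonneg[of "1 / 2"] by linarith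
  with K'[of c] c show False by simp
qed

text \<open>Convexity on [0, 1]: a fixed point lies between 0, where the kernel is positive, and a
  point below the diagonal. Its slope is below 1 because the chord from e to the fixed point 1 has
  slope exactly 1. The last clause measures the drop below the diagonal against 1 - c, uniformly up
  to 1.\<close>

lemma arc_kernel_fixed_point:
  obtains e where "0 < e" "e < 1" "arc_kernel \<alpha> e = e" "arc_kernel' \<alpha> e < 1"
    "\<And>c. -1 \<le> c \<Longrightarrow> c < e \<Longrightarrow> c < arc_kernel \<alpha> c"
    "\<And>d. e < d \<Longrightarrow> d < 1 \<Longrightarrow> \<exists>m>0. \<forall>c\<in>{d..<1}. m * (1 - c) \<le> c - arc_kernel \<alpha> c"
proof -
  let ?K = "arc_kernel \<alpha>" and ?K' = "arc_kernel' \<alpha>"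
  obtain c1 where c1: "0 < c1" "c1 < 1" "?K c1 < c1" by (rule arc_kernel_below_diagonal)
  have "\<exists>e. 0 \<le> e \<and> e \<le> c1 \<and> ?K e - e = 0"
    by (rule IVT2') (use c1 arc_kernel_pos[of 0] in \<open>auto intro!: continuous_intros continuous_on_arc_kernel\<close>)
  then obtain e where e: "0 \<le> e" "e \<le> c1" "?K e = e" by auto
  then have e': "0 < e" "e < 1" using arc_kernel_pos[of 0] c1 by (auto simp: order.order_iff_strict)
  have K'e: "?K' e < 1"
  proof -
    obtain z where z: "e < z" "z < 1" "1 - e = (1 - e) * ?K' z"
      using arc_kernel_MVT[of e 1] e e' by (auto simp: arc_kernel_one)
    then have "?K' z = 1" using e' by simp
    then show ?thesis using arc_kernel'_strict_mono[of e z] z e by simp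
  qed
  have lo: "c < ?K c" if c: "-1 \<le> c" "c < e" for c
  proof (cases "c < 0")
    case True
    then show ?thesis using arc_kernel_nonneg[of c] by simp
  next
    case False
    then obtain z where z: "c < z" "z < e" "e - ?K c = (e - c) * ?K' z"
      using arc_kernel_MVT[of c e] e e' c by auto
    then have "?K' z < 1" using arc_kernel'_strict_mono[of z e] False e' K'e by simp
    then have "(e - c) * ?K' z < (e - c) * 1" using c by (intro mult_strict_left_mono) auto
    then show ?thesis unfolding z(3)[symmetric] by simp
  qed
  have hi: "\<exists>m>0. \<forall>c\<in>{d..<1}. m * (1 - c) \<le> c - ?K c" if d: "e < d" "d < 1" for d
  proof -
    \<comment> \<open>Slopes of chords ending at 1 increase with their left end; stated without
      division.\<close>
    have 1: "(1 - c) * (1 - ?K d) \<le> (1 - d) * (1 - ?K c)" if c: "d \<le> c" "c < 1" "0 \<le> d" for c d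
    proof (cases "c = d")
      case False
      with c obtain z where z: "c < z" "z < 1" "1 - ?K c = (1 - c) * ?K' z"
        using arc_kernel_MVT[of c 1] by (auto simp: arc_kernel_one)
      from False c obtain w where w: "d < w" "w < c" "?K c - ?K d = (c - d) * ?K' w"
        using arc_kernel_MVT[of d c] by auto
      have "?K' w \<le> ?K' z" using arc_kernel'_strict_mono[of w z] z w c by simp
      then have "(c - d) * ?K' w \<le> (c - d) * ?K' z" using c by (intro mult_left_mono) auto
      then have "1 - ?K d \<le> (1 - d) * ?K' z" using z w by (simp add: algebra_simps)
      then have "(1 - c) * (1 - ?K d) \<le> (1 - c) * ((1 - d) * ?K' z)"
        using c by (intro mult_left_mono) auto
      also have "\<dots> = (1 - d) * (1 - ?K c)" unfolding z(3) by simp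
      finally show ?thesis .
    qed simp
    \<comment> \<open>Otherwise the slope over [e, d] would be at least 1 and the slope over [d, 1]
      at most 1, against the strict growth of the derivative.\<close>
    have Kd: "?K d < d"
    proof -
      obtain w where w: "e < w" "w < d" "?K d - e = (d - e) * ?K' w"
        using arc_kernel_MVT[of e d] d e by auto
      obtain z where z: "d < z" "z < 1" "1 - ?K d = (1 - d) * ?K' z"
        using arc_kernel_MVT[of d 1] d e by (auto simp: arc_kernel_one)
      have lt: "?K' w < ?K' z" using arc_kernel'_strict_mono[of w z] z w e by simp
      show ?thesis
      proof (rule ccontr)
        assume "\<not> ?thesis"
        then have "(d - e) * 1 \<le> (d - e) * ?K' w" "(1 - d) * ?K' z \<le> (1 - d) * 1"
          unfolding w(3)[symmetric] z(3)[symmetric] by auto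
        then have "1 \<le> ?K' w" "?K' z \<le> 1"
          using d by (auto intro: mult_left_le_imp_le[of "d - e"] mult_left_le_imp_le[of "1 - d"])
        with lt show False by simp
      qed
    qed
    show ?thesis
    proof (intro exI conjI ballI)
      \<comment> \<open>With this value as m, the chord from d to 1 has slope 1 + m.\<close>
      show "(d - ?K d) / (1 - d) > 0" using Kd d by simp
      fix c assume c: "c \<in> {d..<1}"
      have "(1 - c) * (1 - ?K d) \<le> (1 - d) * (1 - ?K c)" using 1[of d c] c d e by simp
      then have "(d - ?K d) * (1 - c) \<le> (1 - d) * (c - ?K c)" by (simp add: algebra_simps)
      then show "(d - ?K d) / (1 - d) * (1 - c) \<le> c - ?K c" using d by (simp add: field_simps)
    qed
  qed
  show ?thesis using that e e' K'e lo hi by blast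
qed

text \<open>Strict differentiability, from continuity of the derivative at e. Both points vary, so
  that the estimate applies to the difference of two trajectories as well.\<close>

lemma arc_kernel_strict_derivative:
  assumes "0 < e" "e < 1" "0 < \<epsilon>"
  obtains \<delta> where "\<delta> > 0"
    "\<And>x y. \<bar>x - e\<bar> < \<delta> \<Longrightarrow> \<bar>y - e\<bar> < \<delta> \<Longrightarrow>
      \<bar>arc_kernel \<alpha> y - arc_kernel \<alpha> x - arc_kernel' \<alpha> e * (y - x)\<bar> \<le> \<epsilon> * \<bar>y - x\<bar>"
proof -
  let ?K = "arc_kernel \<alpha>" and ?K' = "arc_kernel' \<alpha>"
  have "isCont ?K' e" using arc_kernel'_has_derivative[of \<alpha> e] assms \<alpha> by (auto intro: DERIV_isCont)
  then obtain s where s: "s > 0" "\<And>x. \<bar>x - e\<bar> < s \<Longrightarrow> \<bar>?K' x - ?K' e\<bar> < \<epsilon>"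
    using assms(3) unfolding isCont_def LIM_def dist_real_def by (metis abs_zero diff_self)
  \<comment> \<open>The bounds e and 1 - e keep x and y in [0, 1], as \<open>arc_kernel_MVT\<close>
    requires.\<close>
  define \<delta> where "\<delta> = Min {s, e, 1 - e}"
  have \<delta>: "\<delta> > 0" "\<delta> \<le> s" "\<delta> \<le> e" "\<delta> \<le> 1 - e" using s assms by (auto simp: \<delta>_def)
  have main: "\<bar>?K y - ?K x - ?K' e * (y - x)\<bar> \<le> \<epsilon> * \<bar>y - x\<bar>"
    if "\<bar>x - e\<bar> < \<delta>" "\<bar>y - e\<bar> < \<delta>" "x < y" for x y
  proof -
    have "0 \<le> x" "y \<le> 1" using that \<delta> by linarith+
    with \<open>x < y\<close> obtain z where z: "x < z" "z < y" "?K y - ?K x = (y - x) * ?K' z"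
      by (rule_tac arc_kernel_MVT[of x y])
    have "\<bar>z - e\<bar> < s" using z that \<delta> by linarith
    then have "(y - x) * \<bar>?K' z - ?K' e\<bar> \<le> (y - x) * \<epsilon>"
      using s that by (intro mult_left_mono less_imp_le) auto
    moreover have "?K y - ?K x - ?K' e * (y - x) = (y - x) * (?K' z - ?K' e)"
      using z by (simp add: algebra_simps)
    ultimately show ?thesis using that by (simp add: abs_mult mult.commute)
  qed
  show ?thesis
  proof (rule that[OF \<delta>(1)])
    fix x y assume xy: "\<bar>x - e\<bar> < \<delta>" "\<bar>y - e\<bar> < \<delta>"
    consider "x < y" | "x = y" | "y < x" by linarith
    then show "\<bar>?K y - ?K x - ?K' e * (y - x)\<bar> \<le> \<epsilon> * \<bar>y - x\<bar>"
    proof cases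
      case 3
      have "?K y - ?K x - ?K' e * (y - x) = - (?K x - ?K y - ?K' e * (x - y))"
        by (simp add: algebra_simps)
      with main[OF xy(2,1) 3] show ?thesis by (simp add: abs_minus_commute)
    qed (use main[OF xy] in auto)
  qed
qed

end

section \<open>From the Gaussian pair to the arc integral\<close>

lemma nn_integral_tan_substitution:
  assumes "0 < \<beta>"
  shows "(\<integral>\<^sup>+u. ennreal (alpha_relu \<beta> (c + (1 - u\<^sup>2) / (1 + u\<^sup>2)) / (1 + u\<^sup>2)) \<partial>lborel) = ennreal (arc_integral \<beta> c)"
proof -
  let ?f = "\<lambda>u::real. alpha_relu \<beta> (c + (1 - u\<^sup>2) / (1 + u\<^sup>2)) / (1 + u\<^sup>2)"
  let ?g = "\<lambda>x. alpha_relu \<beta> (c + cos (2 * x))"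
  let ?a = "ereal (-(pi/2))" and ?b = "ereal (pi/2)"
  have u2: "1 + u\<^sup>2 > 0" for u :: real by (simp add: add_pos_nonneg)
  have cos0: "cos x > 0" if "?a < ereal x" "ereal x < ?b" for x
    using that by (intro cos_gt_zero_pi) auto
  \<comment> \<open>With u = tan x the fraction (1 - u^2) / (1 + u^2) is cos (2 x), and the Jacobian
    1 + u^2 cancels the denominator.\<close>
  have fg: "?f (tan x) * (1 + (tan x)\<^sup>2) = ?g x" if "?a < ereal x" "ereal x < ?b" for x
  proof -
    have "(1 - (tan x)\<^sup>2) / (1 + (tan x)\<^sup>2) = ((cos x)\<^sup>2 - (sin x)\<^sup>2) / ((cos x)\<^sup>2 + (sin x)\<^sup>2)"
      using cos0[OF that] by (simp add: tan_def power_divide divide_simps)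
    also have "\<dots> = cos (2 * x)" by (simp add: cos_double)
    finally show ?thesis using u2[of "tan x"] by (simp only: nonzero_eq_divide_eq) simp
  qed
  have g_int: "set_integrable lborel {-(pi/2)..pi/2} ?g"
    by (rule borel_integrable_atLeastAtMost', rule continuous_on_alpha_relu[OF assms])
      (intro continuous_intros)
  then have g_int': "set_integrable lborel (einterval ?a ?b) ?g"
    by (rule set_integrable_subset) (auto simp: einterval_def)
  have int: "set_integrable lborel (einterval ?a ?b) (\<lambda>x. ?f (tan x) * (1 + (tan x)\<^sup>2))"
  proof -
    have "set_integrable lborel (einterval ?a ?b) (\<lambda>x. ?f (tan x) * (1 + (tan x)\<^sup>2)) =
        set_integrable lborel (einterval ?a ?b) ?g"
      by (rule set_integrable_cong) (use fg in \<open>simp_all only: einterval_def mem_Collect_eq\<close>)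
    with g_int' show ?thesis by simp
  qed
  have D: "DERIV tan x :> 1 + (tan x)\<^sup>2" if "?a < ereal x" "ereal x < ?b" for x
    using cos0[OF that] by (auto intro!: derivative_eq_intros simp: tan_sec inverse_eq_divide power_divide)
  have C: "isCont (\<lambda>x. 1 + (tan x)\<^sup>2) x" if "?a < ereal x" "ereal x < ?b" for x
    using cos0[OF that] by (intro continuous_intros) auto
  have "1 + u\<^sup>2 \<noteq> 0" for u :: real using u2[of u] by linarith
  then have "continuous_on UNIV ?f"
    using assms by (intro continuous_intros continuous_on_alpha_relu) auto
  then have f_cont: "isCont ?f (tan x)" for x by (simp add: continuous_on_eq_continuous_at)
  have A: "((ereal \<circ> tan \<circ> real_of_ereal) \<longlongrightarrow> - \<infinity>) (at_right ?a)"
    unfolding ereal_tendsto_simps using filterlim_tan_at_right by simp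
  have B: "((ereal \<circ> tan \<circ> real_of_ereal) \<longlongrightarrow> \<infinity>) (at_left ?b)"
    unfolding ereal_tendsto_simps using filterlim_tan_at_left by simp
  have ab: "?a < ?b" and nn: "0 \<le> ?f (tan x)" "0 \<le> 1 + (tan x)\<^sup>2" for x
    by (auto intro!: divide_nonneg_nonneg alpha_relu_nonneg)
  note sub = interval_integral_substitution_nonneg[OF ab D f_cont C nn A B int]
  have f_int: "integrable lborel ?f"
    using sub(1) by (simp add: einterval_def set_integrable_def)
  have "(LBINT u=-\<infinity>..\<infinity>. ?f u) = (\<integral>u. ?f u \<partial>lborel)"
    by (simp add: interval_lebesgue_integral_def set_lebesgue_integral_def einterval_def)
  moreover have "(LBINT x=?a..?b. ?f (tan x) * (1 + (tan x)\<^sup>2)) = (LBINT x=?a..?b. ?g x)"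
  proof (rule interval_integral_cong)
    fix x assume "x \<in> einterval (min ?a ?b) (max ?a ?b)"
    then have "?a < ereal x" "ereal x < ?b"
      using ab by (auto simp: einterval_def min_def max_def split: if_splits)
    then show "?f (tan x) * (1 + (tan x)\<^sup>2) = ?g x" by (rule fg)
  qed
  moreover have "(LBINT x=?a..?b. ?g x) = arc_integral \<beta> c"
    using g_int by (simp add: interval_integral_Icc arc_integral_def set_borel_integral_eq_integral)
  ultimately have "(\<integral>u. ?f u \<partial>lborel) = arc_integral \<beta> c" using sub(2) by metis
  then show ?thesis
    using nn_integral_eq_integral[OF f_int] by (simp add: alpha_relu_nonneg)
qed

text \<open>Kept in \<open>ennreal\<close>: its finiteness is deduced in
  \<open>JJ_eq_arc_kernel\<close> from \<open>Vt_alpha_relu_pos\<close>, without evaluating the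
  integral.\<close>

definition radial_moment :: "real \<Rightarrow> ennreal" where
  "radial_moment \<alpha> = (\<integral>\<^sup>+r. ennreal (if r > 0 then r * exp (- r\<^sup>2 / 2) * (r\<^sup>2 / 2) powr \<alpha> / (2 * pi) else 0) \<partial>lborel)"

text \<open>Polar coordinates in the half plane \<open>x > 0\<close>, carried out one variable at a time:
  first \<open>y = x u\<close>, then \<open>x = r / sqrt (1 + u\<^sup>2)\<close>.\<close>
lemma nn_integral_gaussian_polar:
  assumes "0 < \<alpha>"
  shows "(\<integral>\<^sup>+x. \<integral>\<^sup>+y. ennreal (if x > 0 then std_normal_density x * std_normal_density y *
      alpha_relu \<alpha> (((1 + c) * x\<^sup>2 - (1 - c) * y\<^sup>2) / 2) else 0) \<partial>lborel \<partial>lborel) =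
    radial_moment \<alpha> * ennreal (arc_integral \<alpha> c)"
proof -
  define n where "n = (\<lambda>x y. ennreal (if x > 0 then std_normal_density x * std_normal_density y *
      alpha_relu \<alpha> (((1 + c) * x\<^sup>2 - (1 - c) * y\<^sup>2) / 2) else 0))"
  define h where "h = (\<lambda>r::real. ennreal (if r > 0 then r * exp (- r\<^sup>2 / 2) * (r\<^sup>2 / 2) powr \<alpha> / (2 * pi) else 0))"
  define f where "f = (\<lambda>u::real. ennreal (alpha_relu \<alpha> (c + (1 - u\<^sup>2) / (1 + u\<^sup>2)) / (1 + u\<^sup>2)))"
  have [measurable]: "case_prod n \<in> borel_measurable (lborel \<Otimes>\<^sub>M lborel)" "h \<in> borel_measurable borel"
     "f \<in> borel_measurable borel"
    unfolding n_def h_def f_def by measurable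
  have [measurable]: "(\<lambda>u. n x (g u)) \<in> borel_measurable borel" if "g \<in> borel_measurable borel" for x g
    using that unfolding n_def by measurable
  have [measurable]: "(\<lambda>x. n x (x * u)) \<in> borel_measurable borel" for u
    unfolding n_def by measurable
  have [measurable]: "(\<lambda>(x, u). ennreal \<bar>x\<bar> * n x (x * u)) \<in> borel_measurable (lborel \<Otimes>\<^sub>M lborel)"
    unfolding n_def by measurable
  have "(\<integral>\<^sup>+x. \<integral>\<^sup>+y. n x y \<partial>lborel \<partial>lborel) = (\<integral>\<^sup>+x. \<integral>\<^sup>+u. ennreal \<bar>x\<bar> * n x (x * u) \<partial>lborel \<partial>lborel)"
  proof (rule nn_integral_cong)
    fix x :: real
    show "(\<integral>\<^sup>+y. n x y \<partial>lborel) = (\<integral>\<^sup>+u. ennreal \<bar>x\<bar> * n x (x * u) \<partial>lborel)"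
    proof (cases "x > 0")
      case True
      then show ?thesis
        by (subst nn_integral_real_affine[where c = x and t = 0]) (simp_all add: nn_integral_cmult)
    qed (simp add: n_def)
  qed
  \<comment> \<open>The order is exchanged because the second substitution rescales x by a factor
    that depends on u.\<close>
  also have "\<dots> = (\<integral>\<^sup>+u. \<integral>\<^sup>+x. ennreal \<bar>x\<bar> * n x (x * u) \<partial>lborel \<partial>lborel)"
    by (rule lborel_pair.Fubini'[symmetric]) simp
  also have "\<dots> = (\<integral>\<^sup>+u. \<integral>\<^sup>+r. h r * f u \<partial>lborel \<partial>lborel)"
  proof (rule nn_integral_cong)
    fix u :: real
    define k where "k = 1 / sqrt (1 + u\<^sup>2)"
    have u2: "1 + u\<^sup>2 > 0" by (simp add: add_pos_nonneg)
    have k: "k > 0" "k\<^sup>2 = 1 / (1 + u\<^sup>2)" "k * k = 1 / (1 + u\<^sup>2)"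
      using u2 by (simp_all add: k_def power_divide)
    \<comment> \<open>The two Jacobians contribute k and k r; their factor k^2 = 1 / (1 + u^2)
      belongs to f, the remaining r to h.\<close>
    have eq: "ennreal \<bar>k\<bar> * (ennreal \<bar>k * r\<bar> * n (k * r) (k * r * u)) = h r * f u" for r
    proof (cases "r > 0")
      case True
      have "std_normal_density (k * r) * std_normal_density (k * r * u) =
          exp (- (k\<^sup>2 * (1 + u\<^sup>2) * r\<^sup>2) / 2) / (2 * pi)"
        by (simp add: std_normal_density_def exp_add[symmetric] power_mult_distrib field_simps)
      also have "k\<^sup>2 * (1 + u\<^sup>2) = 1" using u2 by (simp add: k)
      finally have 1: "std_normal_density (k * r) * std_normal_density (k * r * u) = exp (- r\<^sup>2 / 2) / (2 * pi)"
        by simp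
      have "((1 + c) * (k * r)\<^sup>2 - (1 - c) * (k * r * u)\<^sup>2) / 2 = r\<^sup>2 / 2 * (k\<^sup>2 * ((1 + c) - (1 - c) * u\<^sup>2))"
        by (simp add: power_mult_distrib field_simps)
      also have "k\<^sup>2 * ((1 + c) - (1 - c) * u\<^sup>2) = c + (1 - u\<^sup>2) / (1 + u\<^sup>2)"
        unfolding k using u2 by (simp add: field_simps)
      finally have 2: "alpha_relu \<alpha> (((1 + c) * (k * r)\<^sup>2 - (1 - c) * (k * r * u)\<^sup>2) / 2) =
         (r\<^sup>2 / 2) powr \<alpha> * alpha_relu \<alpha> (c + (1 - u\<^sup>2) / (1 + u\<^sup>2))"
        by (simp only:) (rule alpha_relu_scale, use True in simp)
      have "ennreal \<bar>k\<bar> * (ennreal \<bar>k * r\<bar> * n (k * r) (k * r * u)) =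
         ennreal ((k * k) * r * (exp (- r\<^sup>2 / 2) / (2 * pi) * ((r\<^sup>2 / 2) powr \<alpha> *
            alpha_relu \<alpha> (c + (1 - u\<^sup>2) / (1 + u\<^sup>2)))))"
        using True k(1) unfolding n_def 1 2
        by (simp add: ennreal_mult'[symmetric] alpha_relu_nonneg mult_ac)
      also have "\<dots> = h r * f u"
        using True u2 unfolding h_def f_def k(3)
        by (simp add: ennreal_mult'[symmetric] alpha_relu_nonneg mult_ac)
      finally show ?thesis .
    qed (use k in \<open>simp add: n_def h_def zero_less_mult_iff\<close>)
    have "(\<integral>\<^sup>+x. ennreal \<bar>x\<bar> * n x (x * u) \<partial>lborel) = ennreal \<bar>k\<bar> * (\<integral>\<^sup>+r. ennreal \<bar>k * r\<bar> * n (k * r) (k * r * u) \<partial>lborel)"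
      using k by (subst nn_integral_real_affine[where c = k and t = 0]) simp_all
    also have "\<dots> = (\<integral>\<^sup>+r. ennreal \<bar>k\<bar> * (ennreal \<bar>k * r\<bar> * n (k * r) (k * r * u)) \<partial>lborel)"
      by (subst nn_integral_cmult) (simp_all add: n_def)
    also have "\<dots> = (\<integral>\<^sup>+r. h r * f u \<partial>lborel)" unfolding eq ..
    finally show "(\<integral>\<^sup>+x. ennreal \<bar>x\<bar> * n x (x * u) \<partial>lborel) = (\<integral>\<^sup>+r. h r * f u \<partial>lborel)" .
  qed
  also have "\<dots> = radial_moment \<alpha> * (\<integral>\<^sup>+u. f u \<partial>lborel)"
    by (simp add: nn_integral_multc nn_integral_cmult radial_moment_def h_def[symmetric])
  also have "(\<integral>\<^sup>+u. f u \<partial>lborel) = ennreal (arc_integral \<alpha> c)"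
    unfolding f_def by (rule nn_integral_tan_substitution[OF assms])
  finally show ?thesis unfolding n_def .
qed

text \<open>In the independent normals the two arguments are s x + t y and s x - t y. They sum to 2
  s x, so one of them is at most 0 unless x > 0; and for x > 0 their clipped powers multiply to that
  of s^2 x^2 - t^2 y^2.\<close>

lemma nn_integral_gaussian_pair:
  assumes "0 < \<alpha>" "-1 \<le> c" "c \<le> 1"
  shows "(\<integral>\<^sup>+z. ennreal (alpha_relu \<alpha> (fst z) * alpha_relu \<alpha> (snd z)) \<partial>gaussian_pair 1 c) =
    radial_moment \<alpha> * ennreal (arc_integral \<alpha> c)"
proof -
  interpret N: prob_space std_gaussian by (rule prob_space_std_gaussian)
  define s t where "s = sqrt ((1 + c) / 2)" and "t = sqrt ((1 - c) / 2)"
  have st: "s \<ge> 0" "s\<^sup>2 = (1 + c) / 2" "t\<^sup>2 = (1 - c) / 2" using assms by (auto simp: s_def t_def)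
  let ?r = "\<lambda>x y. alpha_relu \<alpha> (s * x + t * y) * alpha_relu \<alpha> (s * x - t * y)"
  have prod: "?r x y = (if x > 0 then alpha_relu \<alpha> (((1 + c) * x\<^sup>2 - (1 - c) * y\<^sup>2) / 2) else 0)" for x y
  proof (cases "x > 0")
    case True
    have "?r x y = alpha_relu \<alpha> ((s * x + t * y) * (s * x - t * y))"
      using True st by (intro alpha_relu_mult) auto
    also have "(s * x + t * y) * (s * x - t * y) = s\<^sup>2 * x\<^sup>2 - t\<^sup>2 * y\<^sup>2"
      by (simp add: power2_eq_square algebra_simps)
    also have "\<dots> = ((1 + c) * x\<^sup>2 - (1 - c) * y\<^sup>2) / 2"
      unfolding st by (simp add: field_simps)
    finally show ?thesis using True by simp
  next
    case False
    then have "s * x \<le> 0" using st by (simp add: mult_nonneg_nonpos)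
    then have "s * x + t * y \<le> 0 \<or> s * x - t * y \<le> 0" by linarith
    then show ?thesis using False by (auto simp: alpha_relu_def)
  qed
  have "(\<integral>\<^sup>+z. ennreal (alpha_relu \<alpha> (fst z) * alpha_relu \<alpha> (snd z)) \<partial>gaussian_pair 1 c) =
      (\<integral>\<^sup>+z. ennreal (?r (fst z) (snd z)) \<partial>(std_gaussian \<Otimes>\<^sub>M std_gaussian))"
    unfolding gaussian_pair_def s_def[symmetric] t_def[symmetric]
    by (subst nn_integral_distr) (simp_all add: case_prod_beta)
  also have "\<dots> = (\<integral>\<^sup>+x. \<integral>\<^sup>+y. ennreal (?r x y) \<partial>std_gaussian \<partial>std_gaussian)"
    by (subst N.nn_integral_fst[symmetric]) simp_all
  also have "\<dots> = (\<integral>\<^sup>+x. \<integral>\<^sup>+y. ennreal (if x > 0 then std_normal_density x * std_normal_density y *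
      alpha_relu \<alpha> (((1 + c) * x\<^sup>2 - (1 - c) * y\<^sup>2) / 2) else 0) \<partial>lborel \<partial>lborel)"
    unfolding prod
    by (auto simp: nn_integral_density nn_integral_cmult[symmetric] ennreal_mult'[symmetric]
        alpha_relu_nonneg mult_ac intro!: nn_integral_cong)
  finally show ?thesis using nn_integral_gaussian_polar[OF assms(1)] by simp
qed

text \<open>\<open>Vt\<close> at variance 1 equals \<open>Wt\<close> at covariance 1, so numerator
  and denominator of the quotient carry the same radial factor, which cancels.\<close>

lemma JJ_eq_arc_kernel:
  assumes "0 < \<alpha>" "\<alpha> < 1" "-1 \<le> c" "c \<le> 1"
  shows "JJ \<alpha> c = arc_kernel \<alpha> c"
proof -
  interpret N: prob_space std_gaussian by (rule prob_space_std_gaussian)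
  let ?r = "\<lambda>z. alpha_relu \<alpha> (fst z) * alpha_relu \<alpha> (snd z)"
  define V where "V = Vt (alpha_relu \<alpha>) 1"
  have V: "V > 0" using Vt_alpha_relu_pos[of \<alpha> 1] assms by (simp add: V_def)
  have W: "Wt (alpha_relu \<alpha>) 1 c = enn2real (radial_moment \<alpha> * ennreal (arc_integral \<alpha> c))"
    if "-1 \<le> c" "c \<le> 1" for c
    unfolding nn_integral_gaussian_pair[OF assms(1) that, symmetric] Wt_def case_prod_beta
    by (rule integral_eq_nn_integral) (auto simp: gaussian_pair_def alpha_relu_nonneg)
  \<comment> \<open>At covariance 1 both coordinates of the pair equal the first of the two
    normals.\<close>
  have "Wt (alpha_relu \<alpha>) 1 1 = (\<integral>z. (alpha_relu \<alpha> (fst z))\<^sup>2 \<partial>(std_gaussian \<Otimes>\<^sub>M std_gaussian))"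
    unfolding Wt_def gaussian_pair_def by (subst integral_distr) (simp_all add: case_prod_beta power2_eq_square)
  also have "\<dots> = (\<integral>x. (alpha_relu \<alpha> x)\<^sup>2 \<partial>distr (std_gaussian \<Otimes>\<^sub>M std_gaussian) std_gaussian fst)"
    by (subst integral_distr) simp_all
  also have "\<dots> = V"
    by (simp add: N.distr_pair_fst V_def Vt_def gaussian_def integral_distr)
  finally have V1: "enn2real (radial_moment \<alpha> * ennreal (arc_integral \<alpha> 1)) = V" using W[of 1] by simp
  have I1: "arc_integral \<alpha> 1 > 0" using arc_integral_pos assms by simp
  \<comment> \<open>An infinite moment would make the product infinite, and \<open>enn2real\<close>
    sends that to 0, against V > 0.\<close>
  have fin: "radial_moment \<alpha> \<noteq> \<top>"
    using V1 V I1 by (auto simp: ennreal_top_mult)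
  then have V1': "enn2real (radial_moment \<alpha>) * arc_integral \<alpha> 1 = V"
    using V1 I1 by (simp add: enn2real_mult)
  have "Wt (alpha_relu \<alpha>) 1 c = enn2real (radial_moment \<alpha>) * arc_integral \<alpha> c"
    using W[OF assms(3,4)] arc_integral_nonneg[of \<alpha> c] by (simp add: enn2real_mult)
  then show ?thesis
    using V V1' I1 unfolding JJ_def V_def[symmetric] arc_kernel_def by (auto simp: field_simps)
qed

section \<open>Discrete growth estimates\<close>

lemma Suc_powr_ratio_tendsto:
  "(\<lambda>l. real l * ((real (Suc l) / real l) powr \<theta> - 1)) \<longlonglongrightarrow> \<theta>"
proof -
  have "((\<lambda>x. x powr \<theta>) has_real_derivative \<theta> * 1 powr (\<theta> - 1)) (at 1)"
    by (auto intro!: derivative_eq_intros)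
  then have "(\<lambda>h. ((1 + h) powr \<theta> - 1) / h) \<midarrow>0\<rightarrow> \<theta>"
    by (simp add: DERIV_def)
  moreover have "filterlim (\<lambda>l. 1 / real l) (at 0) sequentially"
    unfolding filterlim_at by (auto intro!: lim_1_over_n eventually_mono[OF eventually_gt_at_top[of 0]])
  ultimately have "(\<lambda>l. ((1 + 1 / real l) powr \<theta> - 1) / (1 / real l)) \<longlonglongrightarrow> \<theta>"
    by (rule filterlim_compose)
  then show ?thesis
    by (rule Lim_transform_eventually)
      (auto intro!: eventually_mono[OF eventually_gt_at_top[of 0]] simp: add_divide_distrib add.commute)
qed

text \<open>The strict inequality absorbs the o(1 / l) error of the expansion, so l^\<theta> is a
  subsolution of the recursion with factor 1 + \<kappa> / l; \<open>Suc_powr_ge\<close> gives the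
  supersolution.\<close>

lemma Suc_powr_le:
  assumes "\<theta> < \<kappa>"
  shows "eventually (\<lambda>l. real (Suc l) powr \<theta> \<le> real l powr \<theta> * (1 + \<kappa> / real l)) sequentially"
  using order_tendstoD(2)[OF Suc_powr_ratio_tendsto assms] eventually_gt_at_top[of 0]
proof eventually_elim
  case (elim l)
  then have "(real (Suc l) / real l) powr \<theta> \<le> 1 + \<kappa> / real l" by (simp add: field_simps)
  then have "real l powr \<theta> * (real (Suc l) / real l) powr \<theta> \<le> real l powr \<theta> * (1 + \<kappa> / real l)"
    by (intro mult_left_mono) auto
  then show ?case using elim by (simp add: powr_mult[symmetric])
qed

lemma Suc_powr_ge:
  assumes "\<kappa> < \<theta>"
  shows "eventually (\<lambda>l. real l powr \<theta> * (1 + \<kappa> / real l) \<le> real (Suc l) powr \<theta>) sequentially"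
  using order_tendstoD(1)[OF Suc_powr_ratio_tendsto assms] eventually_gt_at_top[of 0]
proof eventually_elim
  case (elim l)
  then have "1 + \<kappa> / real l \<le> (real (Suc l) / real l) powr \<theta>" by (simp add: field_simps)
  then have "real l powr \<theta> * (1 + \<kappa> / real l) \<le> real l powr \<theta> * (real (Suc l) / real l) powr \<theta>"
    by (intro mult_left_mono) auto
  then show ?case using elim by (simp add: powr_mult[symmetric])
qed

lemma discrete_growth_lower:
  fixes D :: "nat \<Rightarrow> real"
  assumes "\<theta> < \<kappa>"
    and "eventually (\<lambda>l. D (Suc l) \<ge> D l * (1 + \<kappa> / real l)) sequentially"
    and "eventually (\<lambda>l. D l > 0) sequentially"
  obtains C where "C > 0" "eventually (\<lambda>l. C * real l powr \<theta> \<le> D l) sequentially"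
proof -
  have "eventually (\<lambda>l. D (Suc l) \<ge> D l * (1 + \<kappa> / real l) \<and> D l > 0 \<and>
      real (Suc l) powr \<theta> \<le> real l powr \<theta> * (1 + \<kappa> / real l) \<and> l > 0) sequentially"
    using assms(2,3) Suc_powr_le[OF assms(1)] eventually_gt_at_top[of 0] by eventually_elim auto
  then obtain N where N: "D (Suc l) \<ge> D l * (1 + \<kappa> / real l)" "D l > 0"
     "real (Suc l) powr \<theta> \<le> real l powr \<theta> * (1 + \<kappa> / real l)" "l > 0" if "l \<ge> N" for l
    unfolding eventually_sequentially by blast
  define C where "C = D N / real N powr \<theta>"
  have C: "C > 0" using N[of N] by (simp add: C_def)
  have "C * real l powr \<theta> \<le> D l" if "l \<ge> N" for l
    using that
  proof (induction l rule: dec_induct)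
    case base
    then show ?case using N[of N] by (simp add: C_def)
  next
    case (step l)
    \<comment> \<open>\<kappa> may be negative, so the sign of the factor is read off from the
      positive power that it dominates.\<close>
    have "0 < real l powr \<theta> * (1 + \<kappa> / real l)"
      using N(3,4)[of l] step by (intro less_le_trans[OF _ N(3)]) auto
    then have pos: "0 \<le> 1 + \<kappa> / real l" using N(4)[of l] step by (simp add: zero_less_mult_iff)
    have "C * real (Suc l) powr \<theta> \<le> C * (real l powr \<theta> * (1 + \<kappa> / real l))"
      using N(3)[of l] step C by (intro mult_left_mono) auto
    also have "\<dots> \<le> D l * (1 + \<kappa> / real l)"
      using mult_right_mono[OF step.IH pos] by (simp add: mult.assoc)
    also have "\<dots> \<le> D (Suc l)" using N(1)[of l] step by auto
    finally show ?case .
  qed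
  then show ?thesis using that C by (auto simp: eventually_sequentially)
qed

text \<open>For \<theta> \<ge> 1 the surplus C (\<kappa>' - \<kappa>) l^(\<theta> - 1) of the
  comparison power stays above the constant source b, so the source costs nothing in the
  exponent.\<close>

lemma discrete_growth_upper:
  fixes D :: "nat \<Rightarrow> real"
  assumes "0 \<le> \<kappa>" "\<kappa> < \<theta>" "0 \<le> b" "b = 0 \<or> 1 \<le> \<theta>"
    and "eventually (\<lambda>l. D (Suc l) \<le> D l * (1 + \<kappa> / real l) + b) sequentially"
  obtains C where "C > 0" "eventually (\<lambda>l. D l \<le> C * real l powr \<theta>) sequentially"
proof -
  define \<kappa>' where "\<kappa>' = (\<kappa> + \<theta>) / 2"
  have \<kappa>': "\<kappa> < \<kappa>'" "\<kappa>' < \<theta>" using assms by (auto simp: \<kappa>'_def)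
  have "eventually (\<lambda>l. D (Suc l) \<le> D l * (1 + \<kappa> / real l) + b \<and>
      real l powr \<theta> * (1 + \<kappa>' / real l) \<le> real (Suc l) powr \<theta> \<and> l > 0) sequentially"
    using assms(5) Suc_powr_ge[OF \<kappa>'(2)] eventually_gt_at_top[of 0] by eventually_elim auto
  then obtain N where N: "D (Suc l) \<le> D l * (1 + \<kappa> / real l) + b"
     "real l powr \<theta> * (1 + \<kappa>' / real l) \<le> real (Suc l) powr \<theta>" "l > 0" if "l \<ge> N" for l
    unfolding eventually_sequentially by blast
  \<comment> \<open>The first summand covers the start N, the second lets the gap between \<kappa>
    and \<kappa>' absorb b, and 1 makes C positive.\<close>
  define C where "C = \<bar>D N\<bar> / real N powr \<theta> + b / (\<kappa>' - \<kappa>) + 1"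
  have C: "C > 0" "b / (\<kappa>' - \<kappa>) \<le> C" using N[of N] \<kappa>' assms
    by (auto simp: C_def intro!: add_nonneg_pos add_nonneg_nonneg divide_nonneg_nonneg)
  have "D l \<le> C * real l powr \<theta>" if "l \<ge> N" for l
    using that
  proof (induction l rule: dec_induct)
    case base
    have "D N \<le> \<bar>D N\<bar> / real N powr \<theta> * real N powr \<theta>" using N[of N] by simp
    also have "\<dots> \<le> C * real N powr \<theta>" using \<kappa>' assms by (intro mult_right_mono) (auto simp: C_def)
    finally show ?case .
  next
    case (step l)
    have l: "real l > 0" using N(3)[of l] step by simp
    have b: "b \<le> C * (\<kappa>' - \<kappa>) * (real l powr \<theta> / real l)"
    proof (cases "b = 0")
      case True
      then show ?thesis using C \<kappa>' by simp
    next
      case False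
      then have "real l powr 1 \<le> real l powr \<theta>" using assms l by (intro powr_mono) auto
      then have "1 \<le> real l powr \<theta> / real l" using l by simp
      moreover have "b \<le> C * (\<kappa>' - \<kappa>)" using C \<kappa>' by (simp add: field_simps)
      ultimately show ?thesis using mult_mono[of b "C * (\<kappa>' - \<kappa>)" 1 "real l powr \<theta> / real l"] C \<kappa>'
        by simp
    qed
    have "D (Suc l) \<le> D l * (1 + \<kappa> / real l) + b" using N(1)[of l] step by auto
    also have "D l * (1 + \<kappa> / real l) \<le> C * real l powr \<theta> * (1 + \<kappa> / real l)"
      using step assms l by (intro mult_right_mono) auto
    also have "C * real l powr \<theta> * (1 + \<kappa> / real l) + b \<le>
       C * real l powr \<theta> * (1 + \<kappa> / real l) + C * (\<kappa>' - \<kappa>) * (real l powr \<theta> / real l)"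
      using b by simp
    also have "\<dots> = C * (real l powr \<theta> * (1 + \<kappa>' / real l))"
      using l by (simp add: field_simps)
    also have "\<dots> \<le> C * real (Suc l) powr \<theta>" using N(2)[of l] step C by (intro mult_left_mono) auto
    finally show ?case by simp
  qed
  then show ?thesis using that C by (auto simp: eventually_sequentially)
qed

lemma filterlim_powr_at_top:
  assumes "0 < \<theta>" shows "filterlim (\<lambda>x::real. x powr \<theta>) at_top at_top"
proof -
  have "filterlim (\<lambda>x::real. exp (\<theta> * ln x)) at_top at_top"
    by (intro filterlim_compose[OF exp_at_top] filterlim_tendsto_pos_mult_at_top[OF tendsto_const assms]
        ln_at_top)
  then show ?thesis
    by (rule filterlim_mono_eventually)
      (auto intro!: eventually_mono[OF eventually_gt_at_top[of 0]] simp: powr_def)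
qed

text \<open>Serves to refute boundedness: a bounded positive quantity cannot gain a factor 1 +
  \<kappa> / l in all late steps.\<close>

lemma discrete_growth_unbounded:
  fixes D :: "nat \<Rightarrow> real"
  assumes "0 < \<kappa>"
    and "eventually (\<lambda>l. D (Suc l) \<ge> D l * (1 + \<kappa> / real l)) sequentially"
    and "eventually (\<lambda>l. D l > 0) sequentially"
  shows "filterlim D at_top sequentially"
proof -
  obtain C where C: "C > 0" "eventually (\<lambda>l. C * real l powr (\<kappa> / 2) \<le> D l) sequentially"
    using discrete_growth_lower[of "\<kappa> / 2" \<kappa> D] assms by auto
  have "filterlim (\<lambda>l. real l powr (\<kappa> / 2)) at_top sequentially"
    by (rule filterlim_compose[OF filterlim_powr_at_top filterlim_real_sequentially]) (use assms in simp)
  then have "filterlim (\<lambda>l. C * real l powr (\<kappa> / 2)) at_top sequentially"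
    using C by (intro filterlim_tendsto_pos_mult_at_top[OF tendsto_const]) auto
  then show ?thesis using C(2) by (rule filterlim_at_top_mono)
qed

text \<open>Past N the increments average to L within r / 2, and the contribution of N itself is
  divided away.\<close>

lemma stolz_cesaro:
  fixes x :: "nat \<Rightarrow> real"
  assumes "(\<lambda>n. x (Suc n) - x n) \<longlonglongrightarrow> L"
  shows "(\<lambda>n. x n / real n) \<longlonglongrightarrow> L"
proof (rule LIMSEQ_I)
  fix r :: real assume r: "0 < r"
  then obtain N where N: "\<bar>x (Suc n) - x n - L\<bar> < r / 2" if "n \<ge> N" for n
    using LIMSEQ_D[OF assms, of "r / 2"] by auto
  have step: "\<bar>x n - x N - L * (real n - real N)\<bar> \<le> r / 2 * (real n - real N)" if "n \<ge> N" for n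
    using that
  proof (induction n rule: dec_induct)
    case (step n)
    let ?d = "x n - x N - L * (real n - real N)" and ?e = "x (Suc n) - x n - L"
    have "x (Suc n) - x N - L * (real (Suc n) - real N) = ?d + ?e"
      by (simp add: algebra_simps)
    then have "\<bar>x (Suc n) - x N - L * (real (Suc n) - real N)\<bar> \<le> \<bar>?d\<bar> + \<bar>?e\<bar>"
      using abs_triangle_ineq[of ?d ?e] by simp
    also have "\<dots> \<le> r / 2 * (real n - real N) + r / 2"
      using step N[of n] by (intro add_mono) auto
    also have "\<dots> = r / 2 * (real (Suc n) - real N)"
      by (simp add: field_simps)
    finally show ?case .
  qed simp
  have "(\<lambda>n. \<bar>x N - L * real N\<bar> / real n) \<longlonglongrightarrow> 0"
    by (rule lim_const_over_n)
  then have "eventually (\<lambda>n. \<bar>x N - L * real N\<bar> / real n < r / 2) sequentially"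
    using r by (intro order_tendstoD(2)) auto
  then have "eventually (\<lambda>n. norm (x n / real n - L) < r) sequentially"
    using eventually_ge_at_top[of "max 1 N"]
  proof eventually_elim
    case (elim n)
    then have n: "real n > 0" "n \<ge> N" by auto
    have "\<bar>x n - L * real n\<bar> \<le> r / 2 * (real n - real N) + \<bar>x N - L * real N\<bar>"
    proof -
      have "x n - L * real n = (x n - x N - L * (real n - real N)) + (x N - L * real N)"
        by (simp add: algebra_simps)
      then show ?thesis using step[OF n(2)]
          abs_triangle_ineq[of "x n - x N - L * (real n - real N)" "x N - L * real N"] by linarith
    qed
    also have "\<dots> < r * real n"
    proof -
      have "\<bar>x N - L * real N\<bar> < r / 2 * real n" using elim n by (simp add: field_simps)
      moreover have "0 \<le> r * real N" using r by simp
      ultimately show ?thesis unfolding right_diff_distrib by linarith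
    qed
    finally have "\<bar>x n - L * real n\<bar> / real n < r" using n by (simp add: field_simps)
    moreover have "x n / real n - L = (x n - L * real n) / real n" using n by (simp add: field_simps)
    ultimately show ?case using n by (simp add: abs_divide)
  qed
  then show "\<exists>no. \<forall>n\<ge>no. norm (x n / real n - L) < r" by (simp add: eventually_sequentially)
qed

section \<open>The mean-field recursion\<close>

text \<open>Isolates what the dynamics uses of the kernel. \<open>K_above\<close> and
  \<open>K_below\<close> drive the ratio towards e, the latter with a margin proportional to 1 - x
  because the ratio may start arbitrarily close to the other fixed point 1. \<open>K_deriv\<close>
  has two free points so that it applies to pairs of trajectories.\<close>

locale kernel_recursion =
  fixes K :: "real \<Rightarrow> real" and e j \<alpha> A a :: real and P :: "nat \<Rightarrow> real"
  assumes \<alpha>: "0 < \<alpha>" "\<alpha> < 1"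
    and A: "0 < A" and a: "0 \<le> a"
    and P0: "0 < P 0"
    and P_Suc: "P (Suc l) = P l + A * P l powr \<alpha> + a"
    and K_mono: "x \<le> y \<Longrightarrow> K x \<le> K y"
    and K_nonneg: "0 \<le> K x"
    and K_one: "K 1 = 1"
    and K_cont: "continuous_on UNIV K"
    and e: "0 < e" "e < 1" "K e = e"
    and K_above: "-1 \<le> x \<Longrightarrow> x < e \<Longrightarrow> x < K x"
    and K_below: "e < d \<Longrightarrow> d < 1 \<Longrightarrow> \<exists>m>0. \<forall>x\<in>{d..<1}. m * (1 - x) \<le> x - K x"
    and j: "0 < j"
    and K_deriv: "0 < \<epsilon> \<Longrightarrow> \<exists>\<delta>>0. \<forall>x y. \<bar>x - e\<bar> < \<delta> \<longrightarrow> \<bar>y - e\<bar> < \<delta> \<longrightarrow>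
      \<bar>K y - K x - j * (y - x)\<bar> \<le> \<epsilon> * \<bar>y - x\<bar>"
begin

text \<open>By \<open>step_size_asymp\<close> this behaves like 1 / ((1 - \<alpha>) l), the link
  between the recursion and powers of l.\<close>

definition step_size :: "nat \<Rightarrow> real" where "step_size l = A * P l powr \<alpha> / P l"

text \<open>The strict bound \<open>G 0 < P 0\<close> leaves out G = P, which sits at the fixed
  point 1 of K.\<close>

definition trajectory :: "(nat \<Rightarrow> real) \<Rightarrow> bool" where
  "trajectory G \<longleftrightarrow> - P 0 \<le> G 0 \<and> G 0 < P 0 \<and>
     (\<forall>l. G (Suc l) = G l + A * P l powr \<alpha> * K (G l / P l) + a)"

lemma trajectory_Suc: "trajectory G \<Longrightarrow> G (Suc l) = G l + A * P l powr \<alpha> * K (G l / P l) + a"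
  by (simp add: trajectory_def)

section \<open>Growth of P\<close>

lemma P_ge: "P 0 \<le> P l"
proof (induction l)
  case (Suc l)
  have "0 \<le> A * P l powr \<alpha> + a" using A a by simp
  with Suc show ?case using P_Suc[of l] by linarith
qed simp

lemma P_pos: "0 < P l" using P_ge[of l] P0 by linarith

lemma step_size_pos: "0 < step_size l" using P_pos[of l] A by (simp add: step_size_def)

lemma A_powr_eq: "A * P l powr \<alpha> = step_size l * P l" using P_pos[of l] by (simp add: step_size_def)

lemma A_powr_pos: "0 < A * P l powr \<alpha>" using P_pos[of l] A by simp

lemma P_le_Suc: "P l \<le> P (Suc l)" using A_powr_pos[of l] a P_Suc[of l] by linarith

lemma P_at_top: "filterlim P at_top sequentially"
proof -
  have "real l * (A * P 0 powr \<alpha>) \<le> P l" for l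
  proof (induction l)
    case (Suc l)
    have "A * P 0 powr \<alpha> \<le> A * P l powr \<alpha>"
      using P0 P_ge[of l] \<alpha> A by (intro mult_left_mono powr_mono2) auto
    then show ?case using Suc P_Suc[of l] a by (simp add: algebra_simps)
  qed (use P0 in simp)
  moreover have "filterlim (\<lambda>l. real l * (A * P 0 powr \<alpha>)) at_top sequentially"
    by (rule filterlim_at_top_mult_tendsto_pos[OF tendsto_const _ filterlim_real_sequentially])
      (rule A_powr_pos)
  ultimately show ?thesis by (auto intro: filterlim_at_top_mono)
qed

lemma P_powr_tendsto_0: "\<theta> < 0 \<Longrightarrow> (\<lambda>l. P l powr \<theta>) \<longlonglongrightarrow> 0"
  by (rule tendsto_neg_powr[OF _ P_at_top])

lemma P_powr_at_top: "0 < \<theta> \<Longrightarrow> filterlim (\<lambda>l. P l powr \<theta>) at_top sequentially"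
  by (rule filterlim_compose[OF filterlim_powr_at_top P_at_top])

lemma P_Suc_ratio: "(\<lambda>l. P (Suc l) / P l) \<longlonglongrightarrow> 1"
proof -
  have "(\<lambda>l. 1 + A * P l powr (\<alpha> - 1) + a * P l powr (-1)) \<longlonglongrightarrow> 1 + A * 0 + a * 0"
    using \<alpha> by (intro tendsto_intros P_powr_tendsto_0) auto
  moreover have "1 + A * P l powr (\<alpha> - 1) + a * P l powr (-1) = P (Suc l) / P l" for l
    using P_pos[of l] by (simp add: P_Suc powr_diff powr_minus field_simps)
  ultimately show ?thesis by simp
qed

text \<open>The discrete form of (P^(1 - \<alpha>))' = (1 - \<alpha>) (A + a P^(-\<alpha>)), whose
  last term fades; \<open>stolz_cesaro\<close> sums the increments.\<close>

lemma P_powr_over_n: "(\<lambda>l. P l powr (1 - \<alpha>) / real l) \<longlonglongrightarrow> (1 - \<alpha>) * A"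
proof (rule stolz_cesaro)
  let ?h = "\<lambda>l. (1 - \<alpha>) * (A + a * P l powr (- \<alpha>))"
  have h: "(P (Suc l) - P l) * P l powr (- \<alpha>) = A + a * P l powr (- \<alpha>)" for l
    using P_pos[of l] by (simp add: P_Suc powr_minus field_simps)
  have ivt: "\<exists>z. P l < z \<and> z < P (Suc l) \<and>
      P (Suc l) powr (1 - \<alpha>) - P l powr (1 - \<alpha>) = (P (Suc l) - P l) * ((1 - \<alpha>) * z powr (- \<alpha>))" for l
  proof (rule MVT2)
    show "P l < P (Suc l)" using A_powr_pos[of l] a P_Suc[of l] by linarith
    fix x assume "P l \<le> x" "x \<le> P (Suc l)"
    then show "((\<lambda>x. x powr (1 - \<alpha>)) has_real_derivative (1 - \<alpha>) * x powr - \<alpha>) (at x)"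
      using P_pos[of l] by (auto intro!: derivative_eq_intros)
  qed
  \<comment> \<open>The intermediate point lies between \<open>P l\<close> and
    \<open>P (Suc l)\<close>, whose ratio tends to 1, so both bounds have the same limit.\<close>
  have bounds: "?h l * (P (Suc l) / P l) powr (- \<alpha>) \<le> P (Suc l) powr (1 - \<alpha>) - P l powr (1 - \<alpha>)"
    "P (Suc l) powr (1 - \<alpha>) - P l powr (1 - \<alpha>) \<le> ?h l" for l
  proof -
    obtain z where z: "P l < z" "z < P (Suc l)"
      "P (Suc l) powr (1 - \<alpha>) - P l powr (1 - \<alpha>) = (P (Suc l) - P l) * ((1 - \<alpha>) * z powr (- \<alpha>))"
      using ivt[of l] by blast
    have "z powr (- \<alpha>) \<le> P l powr (- \<alpha>)" "P (Suc l) powr (- \<alpha>) \<le> z powr (- \<alpha>)"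
      using z P_pos[of l] \<alpha> by (intro powr_mono2'; simp)+
    moreover have "0 \<le> (P (Suc l) - P l) * (1 - \<alpha>)" using P_le_Suc[of l] \<alpha> by simp
    ultimately have *: "(P (Suc l) - P l) * (1 - \<alpha>) * z powr (- \<alpha>) \<le> (P (Suc l) - P l) * (1 - \<alpha>) * P l powr (- \<alpha>)"
       "(P (Suc l) - P l) * (1 - \<alpha>) * P (Suc l) powr (- \<alpha>) \<le> (P (Suc l) - P l) * (1 - \<alpha>) * z powr (- \<alpha>)"
      by (auto intro: mult_left_mono)
    show "P (Suc l) powr (1 - \<alpha>) - P l powr (1 - \<alpha>) \<le> ?h l"
      using *(1) h[of l, symmetric] z(3) by (simp add: mult_ac)
    have "P (Suc l) powr (- \<alpha>) = P l powr (- \<alpha>) * (P (Suc l) / P l) powr (- \<alpha>)"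
      using P_pos[of l] P_pos[of "Suc l"] by (simp add: powr_divide)
    then show "?h l * (P (Suc l) / P l) powr (- \<alpha>) \<le> P (Suc l) powr (1 - \<alpha>) - P l powr (1 - \<alpha>)"
      using *(2) h[of l, symmetric] z(3) by (simp add: mult_ac)
  qed
  have "?h \<longlonglongrightarrow> (1 - \<alpha>) * (A + a * 0)"
    using \<alpha> by (intro tendsto_intros P_powr_tendsto_0) auto
  then have lim: "?h \<longlonglongrightarrow> (1 - \<alpha>) * A" by simp
  have "(\<lambda>l. ?h l * (P (Suc l) / P l) powr (- \<alpha>)) \<longlonglongrightarrow> (1 - \<alpha>) * A * 1 powr (- \<alpha>)"
    by (intro tendsto_mult lim tendsto_powr P_Suc_ratio tendsto_const) auto
  then have lim': "(\<lambda>l. ?h l * (P (Suc l) / P l) powr (- \<alpha>)) \<longlonglongrightarrow> (1 - \<alpha>) * A" by simp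
  show "(\<lambda>l. P (Suc l) powr (1 - \<alpha>) - P l powr (1 - \<alpha>)) \<longlonglongrightarrow> (1 - \<alpha>) * A"
    by (rule tendsto_sandwich[OF _ _ lim' lim]) (use bounds in auto)
qed

lemma P_bigtheta: "P \<in> \<Theta>(\<lambda>l. real l powr (1 / (1 - \<alpha>)))"
proof (rule bigthetaI_tendsto)
  have "(\<lambda>l. (P l powr (1 - \<alpha>) / real l) powr (1 / (1 - \<alpha>))) \<longlonglongrightarrow> ((1 - \<alpha>) * A) powr (1 / (1 - \<alpha>))"
    using \<alpha> A by (intro tendsto_powr P_powr_over_n tendsto_const) auto
  moreover have "(P l powr (1 - \<alpha>) / real l) powr (1 / (1 - \<alpha>)) = P l / real l powr (1 / (1 - \<alpha>))" for l
    using P_pos[of l] \<alpha> by (simp add: powr_divide powr_powr)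
  ultimately show "(\<lambda>l. P l / real l powr (1 / (1 - \<alpha>))) \<longlonglongrightarrow> ((1 - \<alpha>) * A) powr (1 / (1 - \<alpha>))"
    by simp
  show "((1 - \<alpha>) * A) powr (1 / (1 - \<alpha>)) \<noteq> 0" using \<alpha> A by simp
qed

lemma step_size_asymp: "(\<lambda>l. real l * step_size l) \<longlonglongrightarrow> 1 / (1 - \<alpha>)"
proof -
  have "(\<lambda>l. A / (P l powr (1 - \<alpha>) / real l)) \<longlonglongrightarrow> A / ((1 - \<alpha>) * A)"
    using \<alpha> A by (intro tendsto_intros P_powr_over_n) auto
  moreover have "A / (P l powr (1 - \<alpha>) / real l) = real l * step_size l" for l
    using P_pos[of l] by (simp add: step_size_def powr_diff)
  ultimately show ?thesis using A by simp
qed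

text \<open>b * \<open>step_size l\<close> behaves like b / ((1 - \<alpha>) l); the strict
  inequality leaves room for the error of this asymptotics.\<close>

lemma step_size_ge:
  assumes "c * (1 - \<alpha>) < b" "0 \<le> b"
  shows "eventually (\<lambda>l. c / real l \<le> b * step_size l) sequentially"
proof -
  have "(\<lambda>l. b * (real l * step_size l)) \<longlonglongrightarrow> b * (1 / (1 - \<alpha>))"
    by (intro tendsto_intros step_size_asymp)
  moreover have "c < b * (1 / (1 - \<alpha>))" using assms \<alpha> by (simp add: field_simps)
  ultimately have "eventually (\<lambda>l. c < b * (real l * step_size l)) sequentially" by (rule order_tendstoD(1))
  then show ?thesis using eventually_gt_at_top[of 0]
    by eventually_elim (simp add: field_simps)
qed

lemma step_size_le:
  assumes "b < c * (1 - \<alpha>)"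
  shows "eventually (\<lambda>l. b * step_size l \<le> c / real l) sequentially"
proof -
  have "(\<lambda>l. b * (real l * step_size l)) \<longlonglongrightarrow> b * (1 / (1 - \<alpha>))"
    by (intro tendsto_intros step_size_asymp)
  moreover have "b * (1 / (1 - \<alpha>)) < c" using assms \<alpha> by (simp add: field_simps)
  ultimately have "eventually (\<lambda>l. b * (real l * step_size l) < c) sequentially" by (rule order_tendstoD(2))
  then show ?thesis using eventually_gt_at_top[of 0]
    by eventually_elim (simp add: field_simps)
qed

section \<open>Invariants and one-step formulas of a trajectory\<close>

lemma trajectory_bounds:
  assumes "trajectory G" shows "- P l \<le> G l \<and> G l < P l"
proof (induction l)
  case 0
  then show ?case using assms by (simp add: trajectory_def)
next
  case (Suc l)
  have "G l / P l \<le> 1" using Suc P_pos[of l] by simp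
  then have "K (G l / P l) \<le> 1" using K_mono[of "G l / P l" 1] K_one by simp
  then have "A * P l powr \<alpha> * K (G l / P l) \<le> A * P l powr \<alpha> * 1" "0 \<le> A * P l powr \<alpha> * K (G l / P l)"
    using A K_nonneg[of "G l / P l"] mult_left_mono[of "K (G l / P l)" 1 "A * P l powr \<alpha>"] by auto
  then show ?case using Suc P_Suc[of l] P_le_Suc[of l] trajectory_Suc[OF assms, of l] a by linarith
qed

lemma trajectory_ratio_bounds:
  assumes "trajectory G" shows "-1 \<le> G l / P l" "G l / P l < 1"
  using trajectory_bounds[OF assms, of l] P_pos[of l] by (auto simp: field_simps)

lemma trajectory_diff_step:
  assumes "trajectory G"
  shows "G (Suc l) - e * P (Suc l) =
    G l - e * P l + A * P l powr \<alpha> * (K (G l / P l) - K e) + a * (1 - e)"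
  using e(3) by (simp add: P_Suc trajectory_Suc[OF assms] algebra_simps)

text \<open>Convergence is argued with this ratio, whose step shows the sign of K x - x; the rates
  are argued with \<open>trajectory_diff_step\<close>, which is nearly linear close to e.\<close>

lemma trajectory_ratio_step:
  assumes "trajectory G"
  shows "G (Suc l) / P (Suc l) - G l / P l =
    (A * P l powr \<alpha> * (K (G l / P l) - G l / P l) + a * (1 - G l / P l)) / P (Suc l)"
proof -
  have G: "G l = G l / P l * P l" using P_pos[of l] by simp
  have "G (Suc l) - G l / P l * P (Suc l) =
     A * P l powr \<alpha> * (K (G l / P l) - G l / P l) + a * (1 - G l / P l) + (G l - G l / P l * P l)"
    unfolding P_Suc trajectory_Suc[OF assms] by (simp add: algebra_simps)
  then have "G (Suc l) - G l / P l * P (Suc l) =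
     A * P l powr \<alpha> * (K (G l / P l) - G l / P l) + a * (1 - G l / P l)"
    using G by linarith
  moreover have "G (Suc l) / P (Suc l) - G l / P l = (G (Suc l) - G l / P l * P (Suc l)) / P (Suc l)"
    using P_pos[of "Suc l"] by (simp add: diff_divide_distrib)
  ultimately show ?thesis by simp
qed

text \<open>Both increments in \<open>trajectory_diff_step\<close> are nonnegative once G \<ge> e P.
  Hence a trajectory stays below e P forever or is above it from some layer on, the two cases of the
  convergence proof.\<close>

lemma trajectory_above_persists:
  assumes "trajectory G" "e * P k \<le> G k" "k \<le> l"
  shows "e * P l \<le> G l"
  using assms(3,2)
proof (induction l rule: dec_induct)
  case (step l)
  then have "e \<le> G l / P l" using P_pos[of l] by (simp add: field_simps)
  then have "0 \<le> A * P l powr \<alpha> * (K (G l / P l) - K e)"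
    using K_mono A by (intro mult_nonneg_nonneg) auto
  moreover have "0 \<le> a * (1 - e)" using a e by simp
  ultimately show ?case using trajectory_diff_step[OF assms(1), of l] step by linarith
qed simp

section \<open>Convergence of the ratio to e\<close>

lemma A_powr_over_P_Suc: "eventually (\<lambda>l. step_size l / 2 \<le> A * P l powr \<alpha> / P (Suc l)) sequentially"
proof -
  \<comment> \<open>\<open>trajectory_ratio_step\<close> divides by \<open>P (Suc l)\<close> instead
    of \<open>P l\<close>; since their ratio tends to 1, this costs at most a factor 2.\<close>
  have "eventually (\<lambda>l. P (Suc l) / P l < 2) sequentially"
    by (rule order_tendstoD(2)[OF P_Suc_ratio]) simp
  then show ?thesis
  proof eventually_elim
    case (elim l)
    have "step_size l / 2 = step_size l * P l / (2 * P l)" using P_pos[of l] by simp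
    also have "\<dots> \<le> step_size l * P l / P (Suc l)"
      using elim P_pos[of l] P_pos[of "Suc l"] step_size_pos[of l]
      by (intro divide_left_mono) (auto simp: field_simps)
    finally show ?case by (simp add: A_powr_eq)
  qed
qed

text \<open>The ratio increases, hence converges. A limit below e would keep K x - x away from 0,
  and increments of order 1 / l would sum to infinity.\<close>

lemma trajectory_tendsto_from_below:
  assumes "trajectory G" and below: "\<And>l. G l < e * P l"
  shows "(\<lambda>l. G l / P l) \<longlonglongrightarrow> e"
proof -
  let ?c = "\<lambda>l. G l / P l"
  have c: "-1 \<le> ?c l" "?c l < e" for l
    using trajectory_ratio_bounds[OF assms(1)] below[of l] P_pos[of l] by (auto simp: field_simps)
  have step: "A * P l powr \<alpha> / P (Suc l) * (K (?c l) - ?c l) \<le> ?c (Suc l) - ?c l" for l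
  proof -
    have "0 \<le> a * (1 - ?c l)" using a c[of l] e by simp
    then show ?thesis
      unfolding trajectory_ratio_step[OF assms(1)] using P_pos[of "Suc l"]
      by (simp add: field_simps)
  qed
  have "incseq ?c"
  proof (rule incseq_SucI)
    fix l
    have "0 \<le> A * P l powr \<alpha> / P (Suc l) * (K (?c l) - ?c l)"
      using A_powr_pos[of l] P_pos[of "Suc l"] K_above[OF c, of l] by (intro mult_nonneg_nonneg) auto
    with step[of l] show "?c l \<le> ?c (Suc l)" by linarith
  qed
  then obtain L where L: "?c \<longlonglongrightarrow> L" "\<And>l. ?c l \<le> L"
    using incseq_convergent[of ?c e] c by (metis less_imp_le)
  have "L \<le> e" using L(1) by (rule LIMSEQ_le_const2) (use c in \<open>auto intro: less_imp_le\<close>)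
  moreover have "\<not> L < e"
  proof
    assume "L < e"
    have "-1 \<le> L" using c(1)[of 0] L(2)[of 0] by linarith
    define m where "m = (K L - L) / 2"
    have m: "m > 0" using K_above \<open>-1 \<le> L\<close> \<open>L < e\<close> by (simp add: m_def)
    have m3: "3 * m / 12 = m / 4" by simp
    have "isCont K L" using K_cont by (simp add: continuous_on_eq_continuous_at)
    then have "(\<lambda>l. K (?c l) - ?c l) \<longlonglongrightarrow> K L - L"
      using L(1) by (intro tendsto_intros isCont_tendsto_compose[of L K])
    then have "eventually (\<lambda>l. m < K (?c l) - ?c l) sequentially"
      by (rule order_tendstoD(1)) (use m in \<open>simp add: m_def\<close>)
    moreover have "eventually (\<lambda>l. m / 4 / (1 - \<alpha>) / real l \<le> m / 2 * step_size l) sequentially"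
      by (rule step_size_ge) (use m \<alpha> in \<open>simp_all add: field_simps\<close>)
    \<comment> \<open>Adding 2 moves the ratio into [1, 3], so that an increment of order 1 / l
      becomes a factor 1 + const / l. The upper end 3 turns m / 12 into m / 4.\<close>
    ultimately have "eventually (\<lambda>l. ?c (Suc l) + 2 \<ge> (?c l + 2) * (1 + m / 12 / (1 - \<alpha>) / real l)) sequentially"
      using A_powr_over_P_Suc
    proof eventually_elim
      case (elim l)
      have "(?c l + 2) * (m / 12 / (1 - \<alpha>) / real l) \<le> 3 * (m / 12 / (1 - \<alpha>) / real l)"
        using c[of l] e m \<alpha> by (intro mult_right_mono) auto
      also have "\<dots> = (3 * m / 12) / (1 - \<alpha>) / real l" by (simp only: times_divide_eq_right)
      also have "\<dots> = m / 4 / (1 - \<alpha>) / real l" by (simp only: m3)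
      also have "\<dots> \<le> m / 2 * step_size l" by fact
      also have "\<dots> = step_size l / 2 * m" by simp
      also have "\<dots> \<le> A * P l powr \<alpha> / P (Suc l) * (K (?c l) - ?c l)"
        using elim m step_size_pos[of l] less_imp_le[OF A_powr_pos[of l]] less_imp_le[OF P_pos[of "Suc l"]]
        by (intro mult_mono divide_nonneg_nonneg) auto
      also have "\<dots> \<le> ?c (Suc l) - ?c l" by (rule step)
      finally show ?case by (simp add: algebra_simps)
    qed
    moreover have "eventually (\<lambda>l. ?c l + 2 > 0) sequentially"
      using c(1) by (intro always_eventually allI) (smt (verit))
    moreover have "0 < m / 12 / (1 - \<alpha>)" using m \<alpha> by simp
    ultimately have "filterlim (\<lambda>l. ?c l + 2) at_top sequentially"
      by (intro discrete_growth_unbounded)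
    then obtain l where "3 \<le> ?c l + 2"
      unfolding filterlim_at_top using eventually_happens' sequentially_bot by blast
    with c(2)[of l] e show False by simp
  qed
  ultimately show ?thesis using L(1) by simp
qed

text \<open>Above d the pull towards e outweighs the drift from a, so the ratio falls. It cannot
  stay there: 1 - G l / P l would gain factors 1 + const / l without bound, though it is at most
  2.\<close>

lemma trajectory_ratio_eventually_below:
  assumes "trajectory G" "e < d" "d < 1"
  shows "eventually (\<lambda>l. d \<le> G l / P l \<longrightarrow> G (Suc l) / P (Suc l) \<le> G l / P l) sequentially"
    and "frequently (\<lambda>l. G l / P l < d) sequentially"
proof -
  let ?c = "\<lambda>l. G l / P l"
  obtain m where m: "m > 0" "\<And>x. d \<le> x \<Longrightarrow> x < 1 \<Longrightarrow> m * (1 - x) \<le> x - K x"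
    using K_below[OF assms(2,3)] by auto
  note c = trajectory_ratio_bounds[OF assms(1)]
  \<comment> \<open>From then on the drift a (1 - x) is at most half of the pull A P^\<alpha> m (1 -
    x) at the ratio x.\<close>
  have "eventually (\<lambda>l. 2 * a / (A * m) \<le> P l powr \<alpha>) sequentially"
    using P_powr_at_top[OF \<alpha>(1)] unfolding filterlim_at_top by blast
  then have step: "eventually (\<lambda>l. d \<le> ?c l \<longrightarrow> ?c (Suc l) \<le> ?c l - m / 4 * step_size l * (1 - ?c l)) sequentially"
    using A_powr_over_P_Suc
  proof eventually_elim
    case (elim l)
    show ?case
    proof
      assume d: "d \<le> ?c l"
      have pos: "1 - ?c l > 0" using c[of l] by simp
      have "a \<le> A * P l powr \<alpha> * m / 2" using elim(1) A m by (simp add: field_simps)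
      then have "a * (1 - ?c l) \<le> A * P l powr \<alpha> * m / 2 * (1 - ?c l)"
        using pos by (intro mult_right_mono) auto
      moreover have "A * P l powr \<alpha> * (m * (1 - ?c l)) \<le> A * P l powr \<alpha> * (?c l - K (?c l))"
        using m(2)[OF d] c[of l] A_powr_pos[of l] by (intro mult_left_mono) auto
      moreover have "A * P l powr \<alpha> * (K (?c l) - ?c l) = - (A * P l powr \<alpha> * (?c l - K (?c l)))"
        by (simp only: right_diff_distrib minus_diff_eq)
      ultimately have "A * P l powr \<alpha> * (K (?c l) - ?c l) + a * (1 - ?c l) \<le>
          A * P l powr \<alpha> * m / 2 * (1 - ?c l) - A * P l powr \<alpha> * (m * (1 - ?c l))"
        by linarith
      also have "\<dots> = - (A * P l powr \<alpha> * (m / 2 * (1 - ?c l)))"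
      proof -
        have "A * P l powr \<alpha> * m / 2 * (1 - ?c l) = A * P l powr \<alpha> * (m * (1 - ?c l)) / 2"
          "A * P l powr \<alpha> * (m / 2 * (1 - ?c l)) = A * P l powr \<alpha> * (m * (1 - ?c l)) / 2"
          by simp_all
        moreover have "x / 2 - x = - (x / 2)" for x :: real by simp
        ultimately show ?thesis by (simp only:)
      qed
      finally have "A * P l powr \<alpha> * (K (?c l) - ?c l) + a * (1 - ?c l) \<le>
          - (A * P l powr \<alpha> * (m / 2 * (1 - ?c l)))" .
      then have "?c (Suc l) - ?c l \<le> - (A * P l powr \<alpha> * (m / 2 * (1 - ?c l))) / P (Suc l)"
        unfolding trajectory_ratio_step[OF assms(1)] using P_pos[of "Suc l"] by (intro divide_right_mono) auto
      also have "\<dots> = - (A * P l powr \<alpha> / P (Suc l) * (m / 2 * (1 - ?c l)))" by simp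
      also have "\<dots> \<le> - (step_size l / 2 * (m / 2 * (1 - ?c l)))"
        using elim(2) m pos by (intro le_imp_neg_le mult_right_mono) auto
      also have "step_size l / 2 * (m / 2 * (1 - ?c l)) = m / 4 * step_size l * (1 - ?c l)" by (simp add: mult_ac)
      finally show "?c (Suc l) \<le> ?c l - m / 4 * step_size l * (1 - ?c l)" by linarith
    qed
  qed
  then show "eventually (\<lambda>l. d \<le> ?c l \<longrightarrow> ?c (Suc l) \<le> ?c l) sequentially"
  proof eventually_elim
    case (elim l)
    have "0 \<le> m / 4 * step_size l * (1 - ?c l)" using m step_size_pos[of l] c[of l] by (intro mult_nonneg_nonneg) auto
    then show ?case using elim by linarith
  qed
  show "frequently (\<lambda>l. ?c l < d) sequentially"
  proof (rule ccontr)
    assume "\<not> ?thesis"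
    then have "eventually (\<lambda>l. d \<le> ?c l) sequentially" by (simp add: not_frequently not_less)
    moreover have "eventually (\<lambda>l. m / 8 / (1 - \<alpha>) / real l \<le> m / 4 * step_size l) sequentially"
      by (rule step_size_ge) (use m \<alpha> in \<open>simp_all add: field_simps\<close>)
    ultimately have "eventually (\<lambda>l. 1 - ?c (Suc l) \<ge> (1 - ?c l) * (1 + m / 8 / (1 - \<alpha>) / real l)) sequentially"
      using step
    proof eventually_elim
      case (elim l)
      have "(1 - ?c l) * (m / 8 / (1 - \<alpha>) / real l) \<le> (1 - ?c l) * (m / 4 * step_size l)"
        using elim c[of l] by (intro mult_left_mono) auto
      moreover have "?c (Suc l) \<le> ?c l - m / 4 * step_size l * (1 - ?c l)" using elim by blast
      moreover have "(1 - ?c l) * (m / 4 * step_size l) = m / 4 * step_size l * (1 - ?c l)" by (simp only: mult.commute)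
      ultimately show ?case unfolding distrib_left mult_1_right by linarith
    qed
    moreover have "eventually (\<lambda>l. 1 - ?c l > 0) sequentially" using c by simp
    moreover have "0 < m / 8 / (1 - \<alpha>)" using m \<alpha> by simp
    ultimately have "filterlim (\<lambda>l. 1 - ?c l) at_top sequentially"
      by (intro discrete_growth_unbounded)
    then obtain l where "3 \<le> 1 - ?c l"
      unfolding filterlim_at_top using eventually_happens' sequentially_bot by blast
    with c(1)[of l] show False by simp
  qed
qed

text \<open>Late steps are smaller than z - d and never lead upward from above d, so after one late
  visit below d the ratio stays below z.\<close>

lemma trajectory_tendsto_from_above:
  assumes "trajectory G" "e * P k \<le> G k"
  shows "(\<lambda>l. G l / P l) \<longlonglongrightarrow> e"
proof (rule order_tendstoI)
  let ?c = "\<lambda>l. G l / P l"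
  note c = trajectory_ratio_bounds[OF assms(1)]
  show "eventually (\<lambda>l. x < ?c l) sequentially" if "x < e" for x
    using eventually_ge_at_top[of k]
  proof eventually_elim
    case (elim l)
    have "e \<le> ?c l" using trajectory_above_persists[OF assms elim] P_pos[of l] by (simp add: field_simps)
    with that show ?case by simp
  qed
  show "eventually (\<lambda>l. ?c l < y) sequentially" if "e < y" for y
  proof -
    \<comment> \<open>Capping at 1 puts the midpoint d below 1, as
      \<open>trajectory_ratio_eventually_below\<close> requires.\<close>
    define z where "z = min y 1"
    define d where "d = (e + z) / 2"
    have d: "e < d" "d < z" "d < 1" "z \<le> y" using that e by (auto simp: d_def z_def min_def)
    \<comment> \<open>The ratio gains at most twice the relative increment of P, which tends to
      0.\<close>
    have "(\<lambda>l. 2 * (1 - 1 / (P (Suc l) / P l))) \<longlonglongrightarrow> 2 * (1 - 1 / 1)"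
      by (intro tendsto_intros P_Suc_ratio) simp
    then have "eventually (\<lambda>l. 2 * (1 - 1 / (P (Suc l) / P l)) < z - d) sequentially"
      by (rule order_tendstoD(2)) (use d in simp)
    then have small: "eventually (\<lambda>l. ?c (Suc l) - ?c l < z - d) sequentially"
    proof eventually_elim
      case (elim l)
      have "K (?c l) \<le> 1" using K_mono[of "?c l" 1] K_one c[of l] by simp
      then have "A * P l powr \<alpha> * (K (?c l) - ?c l) + a * (1 - ?c l) \<le> A * P l powr \<alpha> * 2 + a * 2"
        using A_powr_pos[of l] a c[of l] by (intro add_mono mult_left_mono) auto
      also have "\<dots> = 2 * (P (Suc l) - P l)" by (simp add: P_Suc algebra_simps)
      finally have "?c (Suc l) - ?c l \<le> 2 * (P (Suc l) - P l) / P (Suc l)"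
        unfolding trajectory_ratio_step[OF assms(1)] using P_pos[of "Suc l"] by (intro divide_right_mono) auto
      also have "\<dots> = 2 * (1 - 1 / (P (Suc l) / P l))"
        using P_pos[of "Suc l"] P_pos[of l] by (simp add: field_simps)
      finally show ?case using elim by linarith
    qed
    have "eventually (\<lambda>l. ?c (Suc l) - ?c l < z - d \<and> (d \<le> ?c l \<longrightarrow> ?c (Suc l) \<le> ?c l)) sequentially"
      using small trajectory_ratio_eventually_below(1)[OF assms(1) d(1,3)] by eventually_elim auto
    then obtain N where N: "?c (Suc l) - ?c l < z - d" "d \<le> ?c l \<longrightarrow> ?c (Suc l) \<le> ?c l" if "l \<ge> N" for l
      unfolding eventually_sequentially by blast
    obtain M where M: "M \<ge> N" "?c M < d"
      using trajectory_ratio_eventually_below(2)[OF assms(1) d(1,3)]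
      unfolding frequently_sequentially by blast
    have "?c l < z" if "l \<ge> M" for l
      using that
    proof (induction l rule: dec_induct)
      case base
      then show ?case using M d by simp
    next
      case (step l)
      then show ?case using N[of l] M by (cases "d \<le> ?c l") auto
    qed
    then have "?c l < y" if "l \<ge> M" for l using d(4) less_le_trans that by blast
    then show ?thesis unfolding eventually_sequentially by blast
  qed
qed

lemma trajectory_tendsto:
  assumes "trajectory G" shows "(\<lambda>l. G l / P l) \<longlonglongrightarrow> e"
proof (cases "\<exists>k. e * P k \<le> G k")
  case True
  then show ?thesis using trajectory_tendsto_from_above[OF assms] by blast
next
  case False
  then show ?thesis using trajectory_tendsto_from_below[OF assms] by (meson not_le)
qed

section \<open>Growth rates of G - e P and of differences of trajectories\<close>

lemma K_diff_ge:
  assumes "j' < j"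
  obtains \<delta> where "0 < \<delta>"
    "\<And>x y. \<bar>x - e\<bar> < \<delta> \<Longrightarrow> \<bar>y - e\<bar> < \<delta> \<Longrightarrow> x \<le> y \<Longrightarrow> j' * (y - x) \<le> K y - K x"
proof -
  obtain \<delta> where \<delta>: "0 < \<delta>" "\<And>x y. \<bar>x - e\<bar> < \<delta> \<Longrightarrow> \<bar>y - e\<bar> < \<delta> \<Longrightarrow>
      \<bar>K y - K x - j * (y - x)\<bar> \<le> (j - j') * \<bar>y - x\<bar>"
    using K_deriv[of "j - j'"] assms by auto
  show ?thesis
  proof (rule that[OF \<delta>(1)])
    fix x y assume "\<bar>x - e\<bar> < \<delta>" "\<bar>y - e\<bar> < \<delta>" "x \<le> y"
    then have "\<bar>K y - K x - j * (y - x)\<bar> \<le> (j - j') * (y - x)" using \<delta>(2)[of x y] by simp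
    then have "j * (y - x) - (j - j') * (y - x) \<le> K y - K x" by linarith
    then show "j' * (y - x) \<le> K y - K x" by (simp add: algebra_simps)
  qed
qed

lemma K_diff_le:
  assumes "j < j'"
  obtains \<delta> where "0 < \<delta>" "\<And>x. \<bar>x - e\<bar> < \<delta> \<Longrightarrow> \<bar>K x - K e\<bar> \<le> j' * \<bar>x - e\<bar>"
proof -
  obtain \<delta> where \<delta>: "0 < \<delta>" "\<And>x y. \<bar>x - e\<bar> < \<delta> \<Longrightarrow> \<bar>y - e\<bar> < \<delta> \<Longrightarrow>
      \<bar>K y - K x - j * (y - x)\<bar> \<le> (j' - j) * \<bar>y - x\<bar>"
    using K_deriv[of "j' - j"] assms by auto
  show ?thesis
  proof (rule that[OF \<delta>(1)])
    fix x assume "\<bar>x - e\<bar> < \<delta>"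
    then have "\<bar>K x - K e - j * (x - e)\<bar> \<le> (j' - j) * \<bar>x - e\<bar>" using \<delta>(2)[of e x] \<delta>(1) by simp
    moreover have "\<bar>j * (x - e)\<bar> = j * \<bar>x - e\<bar>" using j by (simp add: abs_mult)
    ultimately have "\<bar>K x - K e\<bar> \<le> (j' - j) * \<bar>x - e\<bar> + j * \<bar>x - e\<bar>" by linarith
    then show "\<bar>K x - K e\<bar> \<le> j' * \<bar>x - e\<bar>" by (simp add: algebra_simps)
  qed
qed

lemma trajectory_eventually_near:
  assumes "trajectory G" "0 < \<delta>"
  shows "eventually (\<lambda>l. \<bar>G l / P l - e\<bar> < \<delta>) sequentially"
  using tendstoD[OF trajectory_tendsto[OF assms(1)] assms(2)] by (simp add: dist_real_def)

text \<open>Room is left three times: j' < j for linearising K, \<kappa> (1 - \<alpha>) < j' for the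
  asymptotics of \<open>step_size\<close>, and \<theta> < \<kappa> for the comparison with powers of
  l. From \<theta> (1 - \<alpha>) to j, the value \<kappa> (1 - \<alpha>) lies a quarter of the way
  and j' half of it.\<close>

lemma intermediate_rates:
  assumes "0 \<le> \<theta>" "\<theta> < j / (1 - \<alpha>)"
  obtains j' \<kappa> where "0 \<le> j'" "j' < j" "\<theta> < \<kappa>" "\<kappa> * (1 - \<alpha>) < j'"
proof
  have \<theta>: "\<theta> * (1 - \<alpha>) < j" using assms \<alpha> by (simp add: field_simps)
  show "0 \<le> (\<theta> * (1 - \<alpha>) + j) / 2" using assms \<alpha> j by (intro divide_nonneg_nonneg add_nonneg_nonneg) auto
  show "(\<theta> * (1 - \<alpha>) + j) / 2 < j" using \<theta> by simp
  show "\<theta> < (3 * \<theta> + j / (1 - \<alpha>)) / 4" using assms by simp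
  have "(3 * \<theta> + j / (1 - \<alpha>)) / 4 * (1 - \<alpha>) = (3 * (\<theta> * (1 - \<alpha>)) + j) / 4"
    using \<alpha> by (simp add: field_simps)
  then show "(3 * \<theta> + j / (1 - \<alpha>)) / 4 * (1 - \<alpha>) < (\<theta> * (1 - \<alpha>) + j) / 2"
    using \<theta> by simp
qed

text \<open>The source a cancels in the difference, and linearising K at e leaves a factor of about
  1 + j * \<open>step_size l\<close>, wherever the two trajectories lie relative to e P.\<close>

lemma trajectories_diverge:
  assumes G: "trajectory G" and H: "trajectory H" and "G 0 < H 0" and \<theta>: "0 \<le> \<theta>" "\<theta> < j / (1 - \<alpha>)"
  obtains C where "C > 0" "eventually (\<lambda>l. C * real l powr \<theta> \<le> H l - G l) sequentially"
proof -
  let ?D = "\<lambda>l. H l - G l"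
  have step: "?D (Suc l) = ?D l + A * P l powr \<alpha> * (K (H l / P l) - K (G l / P l))" for l
    unfolding trajectory_Suc[OF G] trajectory_Suc[OF H] by (simp add: algebra_simps)
  have pos: "?D l > 0" for l
  proof (induction l)
    case (Suc l)
    then have "G l / P l \<le> H l / P l" using P_pos[of l] by (intro divide_right_mono) auto
    then have "0 \<le> A * P l powr \<alpha> * (K (H l / P l) - K (G l / P l))"
      using K_mono A by (intro mult_nonneg_nonneg) auto
    with Suc show ?case unfolding step by linarith
  qed (use assms in simp)
  obtain j' \<kappa> where r: "0 \<le> j'" "j' < j" "\<theta> < \<kappa>" "\<kappa> * (1 - \<alpha>) < j'"
    using intermediate_rates[OF \<theta>] by blast
  obtain \<delta> where \<delta>: "0 < \<delta>"
    "\<And>x y. \<bar>x - e\<bar> < \<delta> \<Longrightarrow> \<bar>y - e\<bar> < \<delta> \<Longrightarrow> x \<le> y \<Longrightarrow> j' * (y - x) \<le> K y - K x"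
    using K_diff_ge[OF r(2)] by blast
  have "eventually (\<lambda>l. ?D (Suc l) \<ge> ?D l * (1 + \<kappa> / real l)) sequentially"
    using trajectory_eventually_near[OF G \<delta>(1)] trajectory_eventually_near[OF H \<delta>(1)] step_size_ge[OF r(4,1)]
  proof eventually_elim
    case (elim l)
    have "\<kappa> / real l * ?D l \<le> j' * step_size l * ?D l"
      using elim pos[of l] by (intro mult_right_mono) auto
    also have "\<dots> = A * P l powr \<alpha> * (j' * (H l / P l - G l / P l))"
      by (simp add: step_size_def diff_divide_distrib[symmetric])
    also have "\<dots> \<le> A * P l powr \<alpha> * (K (H l / P l) - K (G l / P l))"
      using elim pos[of l] P_pos[of l] A by (intro mult_left_mono \<delta>(2) divide_right_mono) auto
    finally show ?case unfolding step by (simp add: algebra_simps)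
  qed
  then obtain C where "C > 0" "eventually (\<lambda>l. C * real l powr \<theta> \<le> ?D l) sequentially"
    using discrete_growth_lower[OF r(3), of ?D] pos by auto
  then show ?thesis by (rule that)
qed

text \<open>The argument of \<open>trajectories_diverge\<close> with e P as the lower sequence. It
  satisfies the recursion up to the source a (1 - e), which is nonnegative and only helps.\<close>

lemma trajectory_above_grows:
  assumes G: "trajectory G" and "e * P k < G k" and \<theta>: "0 \<le> \<theta>" "\<theta> < j / (1 - \<alpha>)"
  obtains C where "C > 0" "eventually (\<lambda>l. C * real l powr \<theta> \<le> G l - e * P l) sequentially"
proof -
  let ?D = "\<lambda>l. G l - e * P l"
  have ae: "0 \<le> a * (1 - e)" using a e by simp
  have pos: "?D l > 0" if "l \<ge> k" for l
    using that
  proof (induction l rule: dec_induct)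
    case (step l)
    then have "e \<le> G l / P l" using P_pos[of l] by (simp add: field_simps)
    then have "0 \<le> A * P l powr \<alpha> * (K (G l / P l) - K e)"
      using K_mono A by (intro mult_nonneg_nonneg) auto
    with step ae show ?case unfolding trajectory_diff_step[OF G] by linarith
  qed (use assms in simp)
  obtain j' \<kappa> where r: "0 \<le> j'" "j' < j" "\<theta> < \<kappa>" "\<kappa> * (1 - \<alpha>) < j'"
    using intermediate_rates[OF \<theta>] by blast
  obtain \<delta> where \<delta>: "0 < \<delta>"
    "\<And>x y. \<bar>x - e\<bar> < \<delta> \<Longrightarrow> \<bar>y - e\<bar> < \<delta> \<Longrightarrow> x \<le> y \<Longrightarrow> j' * (y - x) \<le> K y - K x"
    using K_diff_ge[OF r(2)] by blast
  have "eventually (\<lambda>l. ?D (Suc l) \<ge> ?D l * (1 + \<kappa> / real l)) sequentially"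
    using trajectory_eventually_near[OF G \<delta>(1)] step_size_ge[OF r(4,1)] eventually_ge_at_top[of k]
  proof eventually_elim
    case (elim l)
    have "\<kappa> / real l * ?D l \<le> j' * step_size l * ?D l"
      using elim pos[of l] by (intro mult_right_mono) auto
    also have "\<dots> = A * P l powr \<alpha> * (j' * (G l / P l - e))"
      using P_pos[of l] by (simp add: step_size_def field_simps)
    also have "\<dots> \<le> A * P l powr \<alpha> * (K (G l / P l) - K e)"
      using elim pos[of l] P_pos[of l] A \<delta>(1) by (intro mult_left_mono \<delta>(2)) (auto simp: field_simps)
    finally show ?case unfolding trajectory_diff_step[OF G] using ae by (simp add: algebra_simps)
  qed
  moreover have "eventually (\<lambda>l. ?D l > 0) sequentially"
    using pos by (auto simp: eventually_sequentially)
  ultimately obtain C where "C > 0" "eventually (\<lambda>l. C * real l powr \<theta> \<le> ?D l) sequentially"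
    using discrete_growth_lower[OF r(3), of ?D] by blast
  then show ?thesis by (rule that)
qed

text \<open>The source a (1 - e) alone accumulates to order l. The hypothesis says that it is absent
  or that j / (1 - \<alpha>) \<ge> 1, so it does not raise the exponent.\<close>

lemma trajectory_diff_upper:
  assumes G: "trajectory G" and res: "a = 0 \<or> 1 - j \<le> \<alpha>" and \<theta>: "j / (1 - \<alpha>) < \<theta>"
  obtains C where "C > 0" "eventually (\<lambda>l. \<bar>G l - e * P l\<bar> \<le> C * real l powr \<theta>) sequentially"
proof -
  let ?D = "\<lambda>l. \<bar>G l - e * P l\<bar>"
  obtain \<kappa> where \<kappa>1: "j / (1 - \<alpha>) < \<kappa>" and \<kappa>: "\<kappa> < \<theta>" using dense[OF \<theta>] by blast
  define j' where "j' = (j + \<kappa> * (1 - \<alpha>)) / 2"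
  from \<kappa>1 have "j < \<kappa> * (1 - \<alpha>)" using \<alpha> by (simp add: field_simps)
  then have j': "j < j'" "j' < \<kappa> * (1 - \<alpha>)" by (auto simp: j'_def)
  have "0 \<le> \<kappa>" using \<kappa>1 j \<alpha> by (meson divide_nonneg_nonneg diff_ge_0_iff_ge less_imp_le order_trans)
  have ae: "0 \<le> a * (1 - e)" using a e by simp
  have \<theta>1: "a * (1 - e) = 0 \<or> 1 \<le> \<theta>"
  proof (cases "a = 0")
    case False
    then have "1 \<le> j / (1 - \<alpha>)" using res \<alpha> by (simp add: field_simps)
    then show ?thesis using \<theta> by simp
  qed simp
  obtain \<delta> where \<delta>: "0 < \<delta>" "\<And>x. \<bar>x - e\<bar> < \<delta> \<Longrightarrow> \<bar>K x - K e\<bar> \<le> j' * \<bar>x - e\<bar>"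
    using K_diff_le[OF j'(1)] by blast
  have "eventually (\<lambda>l. ?D (Suc l) \<le> ?D l * (1 + \<kappa> / real l) + a * (1 - e)) sequentially"
    using trajectory_eventually_near[OF G \<delta>(1)] step_size_le[OF j'(2)]
  proof eventually_elim
    case (elim l)
    have "?D (Suc l) \<le> ?D l + \<bar>A * P l powr \<alpha> * (K (G l / P l) - K e)\<bar> + a * (1 - e)"
      unfolding trajectory_diff_step[OF G] using ae by linarith
    also have "\<bar>A * P l powr \<alpha> * (K (G l / P l) - K e)\<bar> = A * P l powr \<alpha> * \<bar>K (G l / P l) - K e\<bar>"
      using A by (simp add: abs_mult)
    also have "\<dots> \<le> A * P l powr \<alpha> * (j' * \<bar>G l / P l - e\<bar>)"
      using elim A by (intro mult_left_mono \<delta>(2)) auto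
    also have "G l / P l - e = (G l - e * P l) / P l" using P_pos[of l] by (simp add: field_simps)
    also have "A * P l powr \<alpha> * (j' * \<bar>(G l - e * P l) / P l\<bar>) = j' * step_size l * ?D l"
      using P_pos[of l] by (simp add: step_size_def abs_divide)
    also have "j' * step_size l * ?D l \<le> \<kappa> / real l * ?D l"
      using elim by (intro mult_right_mono) auto
    finally show ?case by (simp add: algebra_simps)
  qed
  then obtain C where "C > 0" "eventually (\<lambda>l. ?D l \<le> C * real l powr \<theta>) sequentially"
    using discrete_growth_upper[OF \<open>0 \<le> \<kappa>\<close> \<kappa> ae \<theta>1, of ?D] by blast
  then show ?thesis by (rule that)
qed

lemma P_powr_bounds:
  obtains c1 c2 where "0 < c1" "0 < c2"
    "eventually (\<lambda>l. c1 * real l powr (1 / (1 - \<alpha>)) \<le> P l) sequentially"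
    "eventually (\<lambda>l. P l \<le> c2 * real l powr (1 / (1 - \<alpha>))) sequentially"
proof -
  obtain c2 where c2: "0 < c2" "eventually (\<lambda>l. norm (P l) \<le> c2 * norm (real l powr (1 / (1 - \<alpha>)))) sequentially"
    using bigthetaD1[OF P_bigtheta] by (rule landau_o.bigE)
  obtain c1 where c1: "0 < c1" "eventually (\<lambda>l. norm (P l) \<ge> c1 * norm (real l powr (1 / (1 - \<alpha>)))) sequentially"
    using bigthetaD2[OF P_bigtheta] by (rule landau_omega.bigE)
  from c1(2) have "eventually (\<lambda>l. c1 * real l powr (1 / (1 - \<alpha>)) \<le> P l) sequentially"
    by eventually_elim (use P_pos in \<open>simp add: less_imp_le\<close>)
  moreover from c2(2) have "eventually (\<lambda>l. P l \<le> c2 * real l powr (1 / (1 - \<alpha>))) sequentially"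
    by eventually_elim (use P_pos in \<open>simp add: less_imp_le\<close>)
  ultimately show ?thesis using that c1(1) c2(1) by blast
qed

text \<open>In the application \<open>\<beta> = \<sigma>b\<^sup>2 / \<sigma>w\<^sup>2\<close> is the shift from \<open>p, \<gamma>\<close> to \<open>P, G\<close>.\<close>
context
  fixes \<beta> :: real
  assumes \<beta>: "0 \<le> \<beta>"
begin

section \<open>Undoing the shift by \<beta>\<close>

lemma P_shift_ge: "eventually (\<lambda>l. P l / 2 \<le> P l - \<beta>) sequentially"
proof -
  have "eventually (\<lambda>l. 2 * \<beta> \<le> P l) sequentially"
    using P_at_top unfolding filterlim_at_top by blast
  then show ?thesis by eventually_elim simp
qed

lemma P_shift_ratio: "(\<lambda>l. (P l - \<beta>) / P l) \<longlonglongrightarrow> 1"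
proof -
  have "(\<lambda>l. 1 - \<beta> / P l) \<longlonglongrightarrow> 1 - 0"
    by (intro tendsto_intros tendsto_divide_0[OF tendsto_const] filterlim_at_top_imp_at_infinity P_at_top)
  moreover have "1 - \<beta> / P l = (P l - \<beta>) / P l" for l using P_pos[of l] by (simp add: field_simps)
  ultimately show ?thesis by simp
qed

text \<open>Undoing the shift moves G - e P by the constant \<beta> (1 - e); lower bounds must guard
  against cancellation with it.\<close>

lemma shifted_ratio_diff:
  "eventually (\<lambda>l. \<bar>e - (G l - \<beta>) / (P l - \<beta>)\<bar> = \<bar>(G l - e * P l) - \<beta> * (1 - e)\<bar> / (P l - \<beta>)) sequentially"
  using P_shift_ge
proof eventually_elim
  case (elim l)
  then have pos: "P l - \<beta> > 0" using P_pos[of l] by simp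
  then have "e - (G l - \<beta>) / (P l - \<beta>) = - (((G l - e * P l) - \<beta> * (1 - e)) / (P l - \<beta>))"
    by (simp add: field_simps)
  then show ?case using pos by (simp only: abs_minus abs_divide abs_of_pos)
qed

lemma shifted_ratio_tendsto:
  assumes "trajectory G" shows "(\<lambda>l. (G l - \<beta>) / (P l - \<beta>)) \<longlonglongrightarrow> e"
proof -
  have "(\<lambda>l. (G l / P l - \<beta> / P l) / ((P l - \<beta>) / P l)) \<longlonglongrightarrow> (e - 0) / 1"
    by (intro tendsto_intros P_shift_ratio trajectory_tendsto assms
        tendsto_divide_0[OF tendsto_const] filterlim_at_top_imp_at_infinity P_at_top) simp
  moreover have "(G l / P l - \<beta> / P l) / ((P l - \<beta>) / P l) = (G l - \<beta>) / (P l - \<beta>)" for l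
    unfolding diff_divide_distrib[symmetric] using P_pos[of l] by simp
  ultimately show ?thesis by (simp only: diff_zero div_by_1)
qed

lemma shifted_ratio_soft_bigo:
  assumes "trajectory G" "a = 0 \<or> 1 - j \<le> \<alpha>"
  shows "soft_bigo (\<lambda>l. \<bar>e - (G l - \<beta>) / (P l - \<beta>)\<bar>) (\<lambda>l. real l powr - ((1 - j) / (1 - \<alpha>)))"
  unfolding soft_bigo_def
proof (intro allI impI)
  fix \<epsilon> :: real assume \<epsilon>: "0 < \<epsilon>"
  \<comment> \<open>\<theta> exceeds the growth exponent of G - e P by \<epsilon>; division by P, of
    order l^(1 / (1 - \<alpha>)), gives the exponent - (1 - j) / (1 - \<alpha>) +
    \<epsilon>.\<close>
  define \<theta> where "\<theta> = j / (1 - \<alpha>) + \<epsilon>"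
  have \<theta>: "0 < \<theta>" using \<epsilon> j \<alpha> by (auto simp: \<theta>_def intro: add_nonneg_pos)
  obtain C where C: "C > 0" "eventually (\<lambda>l. \<bar>G l - e * P l\<bar> \<le> C * real l powr \<theta>) sequentially"
    using trajectory_diff_upper[OF assms, of \<theta>] \<epsilon> by (auto simp: \<theta>_def)
  obtain c1 c2 where c1: "0 < c1" "eventually (\<lambda>l. c1 * real l powr (1 / (1 - \<alpha>)) \<le> P l) sequentially"
    using P_powr_bounds by blast
  have exponent: "\<theta> - 1 / (1 - \<alpha>) = - ((1 - j) / (1 - \<alpha>)) + \<epsilon>"
    by (simp add: \<theta>_def diff_divide_distrib)
  show "(\<lambda>l. \<bar>e - (G l - \<beta>) / (P l - \<beta>)\<bar>) \<in> O(\<lambda>l. real l powr - ((1 - j) / (1 - \<alpha>)) * real l powr \<epsilon>)"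
  proof (rule bigoI)
    show "eventually (\<lambda>l. norm \<bar>e - (G l - \<beta>) / (P l - \<beta>)\<bar> \<le>
        (C + \<beta>) * 2 / c1 * norm (real l powr - ((1 - j) / (1 - \<alpha>)) * real l powr \<epsilon>)) sequentially"
      using C(2) c1(2) shifted_ratio_diff[of G] P_shift_ge eventually_gt_at_top[of 0]
    proof eventually_elim
      case (elim l)
      have "1 \<le> real l powr \<theta>" using elim \<theta> by (intro ge_one_powr_ge_zero) auto
      then have "\<beta> * (1 - e) \<le> \<beta> * real l powr \<theta>" using \<beta> e by (intro mult_left_mono) auto
      moreover have "0 \<le> \<beta> * (1 - e)" using \<beta> e by simp
      ultimately have num: "\<bar>(G l - e * P l) - \<beta> * (1 - e)\<bar> \<le> (C + \<beta>) * real l powr \<theta>"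
        using elim(1) by (simp add: distrib_right)
      have "\<bar>e - (G l - \<beta>) / (P l - \<beta>)\<bar> \<le> (C + \<beta>) * real l powr \<theta> / (c1 * real l powr (1 / (1 - \<alpha>)) / 2)"
        unfolding elim(3) using num elim(2,4,5) c1(1) C(1) \<beta>
        by (intro frac_le mult_nonneg_nonneg) auto
      also have "\<dots> = (C + \<beta>) * 2 / c1 * real l powr (\<theta> - 1 / (1 - \<alpha>))"
        using elim(5) by (simp add: powr_diff)
      also have "\<dots> = (C + \<beta>) * 2 / c1 * norm (real l powr - ((1 - j) / (1 - \<alpha>)) * real l powr \<epsilon>)"
        unfolding exponent powr_add by simp
      finally show ?case by simp
    qed
  qed
qed

lemma shifted_ratio_soft_bigomega:
  assumes "\<And>\<theta>. 0 < \<theta> \<Longrightarrow> \<theta> < j / (1 - \<alpha>) \<Longrightarrow> \<exists>C>0.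
    eventually (\<lambda>l. C * real l powr \<theta> \<le> \<bar>(G l - e * P l) - \<beta> * (1 - e)\<bar>) sequentially"
  shows "soft_bigomega (\<lambda>l. \<bar>e - (G l - \<beta>) / (P l - \<beta>)\<bar>) (\<lambda>l. real l powr - ((1 - j) / (1 - \<alpha>)))"
  unfolding soft_bigomega_def
proof (intro allI impI)
  fix \<epsilon> :: real assume \<epsilon>: "0 < \<epsilon>"
  define \<kappa> where "\<kappa> = j / (1 - \<alpha>)"
  \<comment> \<open>The maximum keeps \<theta> positive when \<epsilon> is large.\<close>
  define \<theta> where "\<theta> = max (\<kappa> / 2) (\<kappa> - \<epsilon>)"
  have \<kappa>: "0 < \<kappa>" using j \<alpha> by (simp add: \<kappa>_def)
  have \<theta>: "0 < \<theta>" "\<theta> < \<kappa>" using \<epsilon> \<kappa> by (auto simp: \<theta>_def)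
  obtain C where C: "C > 0" "eventually (\<lambda>l. C * real l powr \<theta> \<le> \<bar>(G l - e * P l) - \<beta> * (1 - e)\<bar>) sequentially"
    using assms[of \<theta>] \<theta> by (auto simp: \<kappa>_def)
  obtain c1 c2 where c2: "0 < c2" "eventually (\<lambda>l. P l \<le> c2 * real l powr (1 / (1 - \<alpha>))) sequentially"
    using P_powr_bounds by blast
  have exponent: "- ((1 - j) / (1 - \<alpha>)) + - \<epsilon> \<le> \<theta> - 1 / (1 - \<alpha>)"
    by (simp add: \<theta>_def \<kappa>_def diff_divide_distrib)
  show "(\<lambda>l. \<bar>e - (G l - \<beta>) / (P l - \<beta>)\<bar>) \<in> \<Omega>(\<lambda>l. real l powr - ((1 - j) / (1 - \<alpha>)) * real l powr - \<epsilon>)"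
  proof (rule landau_omega.bigI)
    show "C / c2 > 0" using C c2 by simp
    show "eventually (\<lambda>l. norm \<bar>e - (G l - \<beta>) / (P l - \<beta>)\<bar> \<ge>
        C / c2 * norm (real l powr - ((1 - j) / (1 - \<alpha>)) * real l powr - \<epsilon>)) sequentially"
      using C(2) c2(2) shifted_ratio_diff[of G] P_shift_ge eventually_gt_at_top[of 0]
    proof eventually_elim
      case (elim l)
      have "C / c2 * norm (real l powr - ((1 - j) / (1 - \<alpha>)) * real l powr - \<epsilon>) =
         C / c2 * real l powr (- ((1 - j) / (1 - \<alpha>)) + - \<epsilon>)"
        by (simp only: powr_add) simp
      also have "\<dots> \<le> C / c2 * real l powr (\<theta> - 1 / (1 - \<alpha>))"
        using exponent elim(5) C c2 by (intro mult_left_mono powr_mono) auto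
      also have "\<dots> = C * real l powr \<theta> / (c2 * real l powr (1 / (1 - \<alpha>)))"
        using elim(5) by (simp add: powr_diff)
      also have "\<dots> \<le> \<bar>(G l - e * P l) - \<beta> * (1 - e)\<bar> / (P l - \<beta>)"
        using elim \<beta> C P_pos[of l] by (intro frac_le) auto
      also have "\<dots> = norm \<bar>e - (G l - \<beta>) / (P l - \<beta>)\<bar>" unfolding elim(3)[symmetric] by simp
      finally show ?case .
    qed
  qed
qed

text \<open>G - e P and \<beta> (1 - e) may partly cancel, but the former grows without bound and
  eventually exceeds twice the constant.\<close>

lemma soft_bigomega_above:
  assumes "trajectory G" "e * P k < G k"
  shows "soft_bigomega (\<lambda>l. \<bar>e - (G l - \<beta>) / (P l - \<beta>)\<bar>) (\<lambda>l. real l powr - ((1 - j) / (1 - \<alpha>)))"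
proof (rule shifted_ratio_soft_bigomega)
  fix \<theta> assume \<theta>: "0 < \<theta>" "\<theta> < j / (1 - \<alpha>)"
  then obtain C where C: "C > 0" "eventually (\<lambda>l. C * real l powr \<theta> \<le> G l - e * P l) sequentially"
    using trajectory_above_grows[OF assms, of \<theta>] by auto
  have "filterlim (\<lambda>l. C * real l powr \<theta>) at_top sequentially"
    using C(1) \<theta>(1)
    by (intro filterlim_tendsto_pos_mult_at_top[OF tendsto_const]
        filterlim_compose[OF filterlim_powr_at_top filterlim_real_sequentially]) auto
  then have "eventually (\<lambda>l. 2 * (\<beta> * (1 - e)) \<le> C * real l powr \<theta>) sequentially"
    unfolding filterlim_at_top by blast
  with C(2) have "eventually (\<lambda>l. C / 2 * real l powr \<theta> \<le> \<bar>(G l - e * P l) - \<beta> * (1 - e)\<bar>) sequentially"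
    by eventually_elim linarith
  then show "\<exists>C>0. eventually (\<lambda>l. C * real l powr \<theta> \<le> \<bar>(G l - e * P l) - \<beta> * (1 - e)\<bar>) sequentially"
    using C(1) by (intro exI[of _ "C / 2"]) auto
qed

text \<open>The negative of the numerator is e P - G + \<beta> (1 - e). Its summands do not compete,
  and it is at least H - G because H never exceeds e P.\<close>

lemma soft_bigomega_below:
  assumes "trajectory G" "trajectory H" "G 0 < H 0" "\<And>l. H l \<le> e * P l"
  shows "soft_bigomega (\<lambda>l. \<bar>e - (G l - \<beta>) / (P l - \<beta>)\<bar>) (\<lambda>l. real l powr - ((1 - j) / (1 - \<alpha>)))"
proof (rule shifted_ratio_soft_bigomega)
  fix \<theta> assume \<theta>: "0 < \<theta>" "\<theta> < j / (1 - \<alpha>)"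
  then obtain C where C: "C > 0" "eventually (\<lambda>l. C * real l powr \<theta> \<le> H l - G l) sequentially"
    using trajectories_diverge[OF assms(1-3), of \<theta>] by auto
  have "0 \<le> \<beta> * (1 - e)" using \<beta> e by simp
  then have le: "H l - G l \<le> \<bar>(G l - e * P l) - \<beta> * (1 - e)\<bar>" for l using assms(4)[of l] by linarith
  have "eventually (\<lambda>l. C * real l powr \<theta> \<le> \<bar>(G l - e * P l) - \<beta> * (1 - e)\<bar>) sequentially"
    using C(2) by eventually_elim (rule order_trans[OF _ le])
  then show "\<exists>C>0. eventually (\<lambda>l. C * real l powr \<theta> \<le> \<bar>(G l - e * P l) - \<beta> * (1 - e)\<bar>) sequentially"
    using C(1) by blast
qed

text \<open>If two trajectories with different starts both failed, neither would ever exceed e P,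
  and then the one with the smaller start would have the full rate by its distance from the other.
  Thus g is the start of a failing trajectory, if there is one.\<close>

lemma soft_bigomega_all_but_one:
  obtains g where "\<And>G. trajectory G \<Longrightarrow> G 0 \<noteq> g \<Longrightarrow>
    soft_bigomega (\<lambda>l. \<bar>e - (G l - \<beta>) / (P l - \<beta>)\<bar>) (\<lambda>l. real l powr - ((1 - j) / (1 - \<alpha>)))"
proof -
  let ?ok = "\<lambda>G. soft_bigomega (\<lambda>l. \<bar>e - (G l - \<beta>) / (P l - \<beta>)\<bar>) (\<lambda>l. real l powr - ((1 - j) / (1 - \<alpha>)))"
  show ?thesis
  proof (cases "\<exists>H. trajectory H \<and> \<not> ?ok H")
    case True
    then obtain H where H: "trajectory H" "\<not> ?ok H" by blast
    show ?thesis
    proof (rule that)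
      fix G assume G: "trajectory G" "G 0 \<noteq> H 0"
      show "?ok G"
      proof (rule ccontr)
        assume bad: "\<not> ?ok G"
        have "G l \<le> e * P l" "H l \<le> e * P l" for l
          using soft_bigomega_above[OF G(1), of l] soft_bigomega_above[OF H(1), of l] bad H(2) by force+
        then show False
          using soft_bigomega_below[OF G(1) H(1)] soft_bigomega_below[OF H(1) G(1)] G(2) bad H(2)
          by (cases "G 0 < H 0") auto
      qed
    qed
  next
    case False
    then show ?thesis using that by blast
  qed
qed

lemma P_shift_bigtheta: "(\<lambda>l. P l - \<beta>) \<in> \<Theta>(\<lambda>l. real l powr (1 / (1 - \<alpha>)))"
  by (rule landau_theta.trans[OF bigthetaI_tendsto[OF _ P_shift_ratio] P_bigtheta]) simp

lemma trajectory_gap_bigtheta: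
  assumes "trajectory G" shows "(\<lambda>l. P l - G l) \<in> \<Theta>(\<lambda>l. P l - \<beta>)"
proof (rule bigthetaI_tendsto)
  have "(\<lambda>l. (1 - G l / P l) / ((P l - \<beta>) / P l)) \<longlonglongrightarrow> (1 - e) / 1"
    by (intro tendsto_intros P_shift_ratio trajectory_tendsto assms) simp
  moreover have "(1 - G l / P l) / ((P l - \<beta>) / P l) = (P l - G l) / (P l - \<beta>)" for l
  proof -
    have "1 - G l / P l = (P l - G l) / P l" using P_pos[of l] by (simp add: field_simps)
    then show ?thesis using P_pos[of l] by simp
  qed
  ultimately show "(\<lambda>l. (P l - G l) / (P l - \<beta>)) \<longlonglongrightarrow> 1 - e" by (simp only: div_by_1)
  show "1 - e \<noteq> 0" using e by simp
qed

end

end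

section \<open>The full residual network\<close>

theorem theoremB18:
  fixes \<alpha> \<sigma>v \<sigma>a \<sigma>w \<sigma>b p0 :: real
  assumes "0 < \<alpha>" "\<alpha> < 1"
    and "0 < \<sigma>v" "0 \<le> \<sigma>a" "0 < \<sigma>w" "0 \<le> \<sigma>b"
  shows "\<exists>e. (\<forall>c. nonunit_fixed_point \<alpha> c \<longleftrightarrow> c = e) \<and>
    JJ \<alpha> field_differentiable at e \<and>
    (\<exists>\<gamma>x. \<forall>p q \<gamma> lam.
      frn_mean_field (alpha_relu \<alpha>) \<sigma>v \<sigma>a \<sigma>w \<sigma>b p q \<gamma> lam \<and>
      p 0 = p0 \<and> - p 0 \<le> \<gamma> 0 \<and> \<gamma> 0 < p 0 \<longrightarrow>
        (\<lambda>l. \<gamma> l / p l) \<longlonglongrightarrow> e \<and>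
        (\<sigma>a = 0 \<or> 1 - deriv (JJ \<alpha>) e \<le> \<alpha> \<longrightarrow>
          soft_bigo (\<lambda>l. \<bar>e - \<gamma> l / p l\<bar>)
            (\<lambda>l. real l powr - ((1 - deriv (JJ \<alpha>) e) / (1 - \<alpha>)))) \<and>
        (\<gamma> 0 \<noteq> \<gamma>x \<longrightarrow>
          soft_bigomega (\<lambda>l. \<bar>e - \<gamma> l / p l\<bar>)
            (\<lambda>l. real l powr - ((1 - deriv (JJ \<alpha>) e) / (1 - \<alpha>)))) \<and>
        (\<lambda>l. p l - \<gamma> l) \<in> \<Theta>(p) \<and>
        p \<in> \<Theta>(\<lambda>l. real l powr (1 / (1 - \<alpha>))))"
proof -
  note \<alpha> = assms(1,2)
  obtain e where e: "0 < e" "e < 1" "arc_kernel \<alpha> e = e" "arc_kernel' \<alpha> e < 1"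
    "\<And>c. -1 \<le> c \<Longrightarrow> c < e \<Longrightarrow> c < arc_kernel \<alpha> c"
    "\<And>d. e < d \<Longrightarrow> d < 1 \<Longrightarrow> \<exists>m>0. \<forall>c\<in>{d..<1}. m * (1 - c) \<le> c - arc_kernel \<alpha> c"
    using arc_kernel_fixed_point[OF \<alpha>] by blast
  have JJ: "JJ \<alpha> c = arc_kernel \<alpha> c" if "-1 \<le> c" "c \<le> 1" for c
    using JJ_eq_arc_kernel[OF \<alpha> that] .
  have unique: "nonunit_fixed_point \<alpha> c \<longleftrightarrow> c = e" for c
  proof
    assume "nonunit_fixed_point \<alpha> c"
    then have c: "-1 \<le> c" "c < 1" "arc_kernel \<alpha> c = c"
      using JJ[of c] by (auto simp: nonunit_fixed_point_def)
    have "\<not> c < e" using e(5)[of c] c by auto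
    moreover have "\<not> e < c"
    proof
      assume "e < c"
      then obtain m where m: "m > 0" "\<forall>x\<in>{c..<1}. m * (1 - x) \<le> x - arc_kernel \<alpha> x"
        using e(6)[of c] c by blast
      then have "m * (1 - c) \<le> 0" "0 < m * (1 - c)" using m(2)[rule_format, of c] c by auto
      then show False by linarith
    qed
    ultimately show "c = e" by simp
  next
    assume "c = e"
    then show "nonunit_fixed_point \<alpha> c" using e JJ[of e] by (auto simp: nonunit_fixed_point_def)
  qed
  have "(arc_kernel \<alpha> has_field_derivative arc_kernel' \<alpha> e) (at e)"
    using arc_kernel_has_derivative[of \<alpha> e] \<alpha> e by simp
  then have J': "(JJ \<alpha> has_field_derivative arc_kernel' \<alpha> e) (at e)"
    by (rule has_field_derivative_transform_within_open[of _ _ _ "{-1<..<1}"])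
      (use e in \<open>auto simp: JJ\<close>)
  have deriv: "deriv (JJ \<alpha>) e = arc_kernel' \<alpha> e" using J' by (rule DERIV_imp_deriv)
  define V where "V = Vt (alpha_relu \<alpha>) 1"
  have V: "V > 0" using Vt_alpha_relu_pos[OF \<alpha>, of 1] by (simp add: V_def)
  define A where "A = \<sigma>v\<^sup>2 * V * (\<sigma>w\<^sup>2) powr \<alpha>"
  define \<beta> where "\<beta> = \<sigma>b\<^sup>2 / \<sigma>w\<^sup>2"
  have A: "A > 0" using assms V by (simp add: A_def)
  have \<beta>: "\<beta> \<ge> 0" by (simp add: \<beta>_def)
  \<comment> \<open>P is built from p0 alone, so the exceptional start can be fixed before the
    mean-field sequences are quantified over.\<close>
  define P where "P = rec_nat (p0 + \<beta>) (\<lambda>_ x. x + A * x powr \<alpha> + \<sigma>a\<^sup>2)"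
  have P: "P 0 = p0 + \<beta>" "P (Suc l) = P l + A * P l powr \<alpha> + \<sigma>a\<^sup>2" for l
    by (simp_all add: P_def)
  show ?thesis
  proof (cases "p0 > 0")
    \<comment> \<open>For p0 \<le> 0 no start satisfies - p 0 \<le> \<gamma> 0 < p 0.\<close>
    case False
    have "JJ \<alpha> field_differentiable at e" using J' by (auto simp: field_differentiable_def)
    then show ?thesis using unique False by (intro exI[of _ e]) auto
  next
    case True
    interpret kernel_recursion "arc_kernel \<alpha>" e "arc_kernel' \<alpha> e" \<alpha> A "\<sigma>a\<^sup>2" P
    proof
      show "\<exists>\<delta>>0. \<forall>x y. \<bar>x - e\<bar> < \<delta> \<longrightarrow> \<bar>y - e\<bar> < \<delta> \<longrightarrow>
        \<bar>arc_kernel \<alpha> y - arc_kernel \<alpha> x - arc_kernel' \<alpha> e * (y - x)\<bar> \<le> \<epsilon> * \<bar>y - x\<bar>"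
        if "0 < \<epsilon>" for \<epsilon>
        using arc_kernel_strict_derivative[OF \<alpha> e(1,2) that] by metis
    qed (use \<alpha> A P e \<beta> True arc_kernel_one[OF \<alpha>] arc_kernel_mono[OF \<alpha>] arc_kernel_nonneg[OF \<alpha>]
        continuous_on_arc_kernel[OF \<alpha>] arc_kernel'_pos[OF \<alpha>] in \<open>auto intro: add_pos_nonneg\<close>)
    obtain g where g: "\<And>G. trajectory G \<Longrightarrow> G 0 \<noteq> g \<Longrightarrow>
      soft_bigomega (\<lambda>l. \<bar>e - (G l - \<beta>) / (P l - \<beta>)\<bar>)
        (\<lambda>l. real l powr - ((1 - arc_kernel' \<alpha> e) / (1 - \<alpha>)))"
      using soft_bigomega_all_but_one[OF \<beta>] by blast
    have traj: "trajectory (\<lambda>l. \<gamma> l + \<beta>) \<and> p = (\<lambda>l. P l - \<beta>)"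
      if frn: "frn_mean_field (alpha_relu \<alpha>) \<sigma>v \<sigma>a \<sigma>w \<sigma>b p q \<gamma> lam"
        and p0: "p 0 = p0" "- p 0 \<le> \<gamma> 0" "\<gamma> 0 < p 0" for p q \<gamma> lam
    proof -
      have eqs: "q (Suc l) = \<sigma>w\<^sup>2 * p l + \<sigma>b\<^sup>2"
        "p (Suc l) = \<sigma>v\<^sup>2 * Vt (alpha_relu \<alpha>) (q (Suc l)) + \<sigma>a\<^sup>2 + p l"
        "lam (Suc l) = \<sigma>w\<^sup>2 * \<gamma> l + \<sigma>b\<^sup>2"
        "\<gamma> (Suc l) = \<sigma>v\<^sup>2 * Wt (alpha_relu \<alpha>) (q (Suc l)) (lam (Suc l)) + \<sigma>a\<^sup>2 + \<gamma> l" for l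
        using frn[unfolded frn_mean_field_def, rule_format, of "Suc l"] by auto
      \<comment> \<open>In terms of P the bias disappears, so the homogeneity of \<open>Vt\<close>
        and \<open>Wt\<close> produces the pure power \<open>P l powr \<alpha>\<close>.\<close>
      have q: "q (Suc l) = \<sigma>w\<^sup>2 * P l" if "p l = P l - \<beta>" for l
        unfolding eqs that using assms by (simp add: \<beta>_def field_simps)
      have qpos: "q (Suc l) > 0" if "p l = P l - \<beta>" for l
        unfolding q[OF that] using assms P_pos[of l] by simp
      have qpow: "\<sigma>v\<^sup>2 * (q (Suc l) powr \<alpha> * V) = A * P l powr \<alpha>" if "p l = P l - \<beta>" for l
        unfolding q[OF that] using P_pos[of l] by (simp add: A_def powr_mult)
      have p: "p l = P l - \<beta>" for l
      proof (induction l)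
        case (Suc l)
        show ?case
          unfolding eqs(2) Vt_alpha_relu[OF qpos[OF Suc]] V_def[symmetric] qpow[OF Suc] P
          using Suc by simp
      qed (simp add: P p0)
      let ?G = "\<lambda>l. \<gamma> l + \<beta>"
      have step: "?G (Suc l) = ?G l + A * P l powr \<alpha> * arc_kernel \<alpha> (?G l / P l) + \<sigma>a\<^sup>2"
        if "- P l \<le> ?G l" "?G l \<le> P l" for l
      proof -
        let ?c = "?G l / P l"
        have c: "-1 \<le> ?c" "?c \<le> 1" using that P_pos[of l] by (auto simp: field_simps)
        have "lam (Suc l) = \<sigma>w\<^sup>2 * ?G l" unfolding eqs using assms by (simp add: \<beta>_def field_simps)
        also have "\<dots> = ?c * q (Suc l)" unfolding q[OF p] using P_pos[of l] by simp
        finally have "Wt (alpha_relu \<alpha>) (q (Suc l)) (lam (Suc l)) = q (Suc l) powr \<alpha> * (V * arc_kernel \<alpha> ?c)"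
          using Wt_alpha_relu[OF qpos[OF p[of l]], of \<alpha> ?c] JJ[OF c] V
          by (simp add: JJ_def V_def[symmetric] field_simps)
        then have "\<gamma> (Suc l) = \<sigma>v\<^sup>2 * (q (Suc l) powr \<alpha> * V) * arc_kernel \<alpha> ?c + \<sigma>a\<^sup>2 + \<gamma> l"
          unfolding eqs(4) by (simp add: mult_ac)
        then show ?thesis unfolding qpow[OF p] by simp
      qed
      \<comment> \<open>\<open>step\<close> is available for ratios in [-1, 1], where
        \<open>JJ\<close> and \<open>arc_kernel\<close> agree; the bounds therefore come first, by
        an induction that uses \<open>step\<close> as it goes.\<close>
      have bounds: "- P l \<le> ?G l \<and> ?G l \<le> P l" for l
      proof (induction l)
        case 0
        then show ?case using p0 \<beta> P(1) by simp
      next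
        case (Suc l)
        have "?G l / P l \<le> 1" using Suc P_pos[of l] by simp
        then have "arc_kernel \<alpha> (?G l / P l) \<le> 1" using K_mono[of "?G l / P l" 1] K_one by simp
        then have "A * P l powr \<alpha> * arc_kernel \<alpha> (?G l / P l) \<le> A * P l powr \<alpha>"
          "0 \<le> A * P l powr \<alpha> * arc_kernel \<alpha> (?G l / P l)"
          using A K_nonneg mult_left_mono[of "arc_kernel \<alpha> (?G l / P l)" 1 "A * P l powr \<alpha>"] by auto
        moreover have "0 \<le> \<sigma>a\<^sup>2" by simp
        ultimately show ?case using Suc step[of l] P(2)[of l] by linarith
      qed
      have "trajectory ?G"
        unfolding trajectory_def using p0 P(1) \<beta> step bounds by auto
      then show ?thesis using p by auto
    qed
    have diff: "JJ \<alpha> field_differentiable at e" using J' by (auto simp: field_differentiable_def)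
    \<comment> \<open>The exceptional start g of G = \<gamma> + \<beta> becomes g - \<beta> for
      \<gamma>.\<close>
    show ?thesis
    proof (rule exI[of _ e], intro conjI[OF allI[OF unique] conjI[OF diff exI[of _ "g - \<beta>"]]] allI impI conjI;
        (elim conjE)?)
      fix p q \<gamma> lam
      assume frn: "frn_mean_field (alpha_relu \<alpha>) \<sigma>v \<sigma>a \<sigma>w \<sigma>b p q \<gamma> lam"
        and p0: "p 0 = p0" "- p 0 \<le> \<gamma> 0" "\<gamma> 0 < p 0"
      from traj[OF this] have T: "trajectory (\<lambda>l. \<gamma> l + \<beta>)" and p: "p = (\<lambda>l. P l - \<beta>)" by auto
      show "(\<lambda>l. \<gamma> l / p l) \<longlonglongrightarrow> e"
        using shifted_ratio_tendsto[OF \<beta> T] by (simp add: p)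
      show "soft_bigo (\<lambda>l. \<bar>e - \<gamma> l / p l\<bar>) (\<lambda>l. real l powr - ((1 - deriv (JJ \<alpha>) e) / (1 - \<alpha>)))"
        if "\<sigma>a = 0 \<or> 1 - deriv (JJ \<alpha>) e \<le> \<alpha>"
        using shifted_ratio_soft_bigo[OF \<beta> T] that unfolding deriv by (simp add: p)
      show "soft_bigomega (\<lambda>l. \<bar>e - \<gamma> l / p l\<bar>) (\<lambda>l. real l powr - ((1 - deriv (JJ \<alpha>) e) / (1 - \<alpha>)))"
        if "\<gamma> 0 \<noteq> g - \<beta>"
        using g[OF T] that unfolding deriv by (simp add: p algebra_simps)
      show "(\<lambda>l. p l - \<gamma> l) \<in> \<Theta>(p)"
        using trajectory_gap_bigtheta[OF \<beta> T] by (simp add: p algebra_simps)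
      show "p \<in> \<Theta>(\<lambda>l. real l powr (1 / (1 - \<alpha>)))"
        unfolding p by (rule P_shift_bigtheta[OF \<beta>])
    qed
  qed
qed

end
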